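(* Let $n$ be a positive integer. Among the functions $\dim_H^D$ $(D\in\mathcal{D})$ on subsets of $\mathbb{R}^n$ there exist continuum many pairwise different ones, each of which differs from the Hausdorff dimension, and each of which, written as $\dim$, satisfies all of the following properties: (1) $\dim S$ equals the similarity dimension of $S$ for every self-similar set $S\subset\mathbb{R}^n$ satisfying the strong separation condition; (2) monotonicity: $A\subset B$ implies $\dim A\le\dim B$; (3) finite stability: $\dim(A\cup B)=\max(\dim A,\dim B)$; (4) bilipschitz invariance: $\dim A=\dim B$ if $A$ and $B$ are bilipschitz equivalent; (5) Lipschitz stability: $\dim f(A)\le\dim A$ if $f\colon\mathbb{R}^n\to\mathbb{R}^n$ is Lipschitz; (6) $\sigma$-stability: $\dim\left(\bigcup_{i=1}^\infty A_i\right)=\sup_i\dim A_i$; (7) measurability: $\dim\colon\mathcal{K}(\mathbb{R}^n)\to[0,n]$ is a Borel function.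
   Context: $|E|$ denotes the diameter of a set $E$. $\mathcal{D}$ is the family of all sets $D\subset(0,\infty)$ with $\inf D=0$ that are open in the Sorgenfrey topology (generated by the intervals $[a,b)$), i.e. for every $t\in D$ there is $\delta>0$ with $[t,t+\delta)\subset D$. For $D\in\mathcal{D}$, $E\subset\mathbb{R}^n$ and $s\ge0$ let $$\mathcal{H}^s_{D,\infty}(E)=\inf\left\{\sum_{i=1}^\infty|E_i|^s: E\subset\bigcup_{i=1}^\infty E_i,\ |E_i|\in D\text{ for all }i\right\},\qquad \dim_H^D E=\inf\{s\ge0:\mathcal{H}^s_{D,\infty}(E)=0\}.$$ $\mathcal{K}(\mathbb{R}^n)$ is the set of non-empty compact subsets of $\mathbb{R}^n$ endowed with the Hausdorff metric. Two sets are bilipschitz equivalent if there is a bijection $f$ between them such that $f$ and $f^{-1}$ are Lipschitz. A self-similar set is a nonempty compact $S\subset\mathbb{R}^n$ with $S=\bigcup_{i=1}^m f_i(S)$ for finitely many contracting similarities $f_i$ with ratios $r_i$; its similarity dimension is the unique $s$ with $\sum_i r_i^s=1$; the strong separation condition means $f_i(S)\cap f_j(S)=\emptyset$ for $i\ne j$. *)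

theory Defs
  imports "HOL-Analysis.Analysis" "HOL-Library.Equipollence"
begin

section \<open>The dimensions \<open>dim\<^sub>H\<^sup>D\<close>\<close>

text \<open>
  The last conjunct is openness in the Sorgenfrey topology. Since \<open>Inf {}\<close> is unspecified
  on \<open>real\<close>, \<open>inf D = 0\<close> is accompanied by \<open>D \<noteq> {}\<close>.
\<close>

definition sorgenfrey_family :: "real set set" where
  "sorgenfrey_family =
     {D. D \<subseteq> {0<..} \<and> D \<noteq> {} \<and> Inf D = 0 \<and> (\<forall>t\<in>D. \<exists>\<delta>>0. {t..<t + \<delta>} \<subseteq> D)}"

text \<open>
  \<open>diameter\<close> is meaningful for bounded sets only; a set of infinite diameter is never
  admissible, as \<open>D \<subseteq> (0, \<infinity>)\<close>. For \<open>D\<close> in the family all diameters occurring are positive,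
  so \<open>powr\<close> is the usual power, also for \<open>s = 0\<close>.
\<close>

definition content_D :: "real set \<Rightarrow> real \<Rightarrow> 'a::metric_space set \<Rightarrow> ennreal" where
  "content_D D s A =
     Inf {(\<Sum>i. ennreal (diameter (E i) powr s)) | E :: nat \<Rightarrow> 'a set.
            A \<subseteq> (\<Union>i. E i) \<and> (\<forall>i. bounded (E i) \<and> diameter (E i) \<in> D)}"

definition dim_D :: "real set \<Rightarrow> 'a::metric_space set \<Rightarrow> ereal" where
  "dim_D D A = Inf {ereal s | s. 0 \<le> s \<and> content_D D s A = 0}"


section \<open>Hausdorff dimension\<close>

text \<open>
  The usual conventions for the \<open>s\<close>-th power of the diameter: it is \<open>0\<close> for the empty set, and
  \<open>1\<close> for nonempty sets if \<open>s = 0\<close> (whereas \<open>0 powr 0 = 0\<close>).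
\<close>

definition diam_power :: "real \<Rightarrow> 'a::metric_space set \<Rightarrow> ennreal" where
  "diam_power s E =
     (if E = {} then 0 else if s = 0 then 1 else ennreal (diameter E powr s))"

definition hausdorff_premeasure :: "real \<Rightarrow> real \<Rightarrow> 'a::metric_space set \<Rightarrow> ennreal" where
  "hausdorff_premeasure \<delta> s A =
     Inf {(\<Sum>i. diam_power s (E i)) | E :: nat \<Rightarrow> 'a set.
            A \<subseteq> (\<Union>i. E i) \<and> (\<forall>i. bounded (E i) \<and> diameter (E i) \<le> \<delta>)}"

definition hausdorff_measure :: "real \<Rightarrow> 'a::metric_space set \<Rightarrow> ennreal" where
  "hausdorff_measure s A = (SUP \<delta>\<in>{0<..}. hausdorff_premeasure \<delta> s A)"

definition hausdorff_dim :: "'a::metric_space set \<Rightarrow> ereal" where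
  "hausdorff_dim A = Inf {ereal s | s. 0 \<le> s \<and> hausdorff_measure s A = 0}"


section \<open>Bilipschitz equivalence\<close>

definition bilipschitz_equivalent :: "'a::metric_space set \<Rightarrow> 'b::metric_space set \<Rightarrow> bool" where
  "bilipschitz_equivalent A B \<longleftrightarrow>
     (\<exists>f. bij_betw f A B \<and> (\<exists>C. C-lipschitz_on A f) \<and> (\<exists>C. C-lipschitz_on B (inv_into A f)))"


section \<open>Self-similar sets\<close>

definition contracting_similarity :: "real \<Rightarrow> ('a::metric_space \<Rightarrow> 'a) \<Rightarrow> bool" where
  "contracting_similarity r f \<longleftrightarrow> 0 < r \<and> r < 1 \<and> (\<forall>x y. dist (f x) (f y) = r * dist x y)"

definition self_similar ::
  "nat \<Rightarrow> (nat \<Rightarrow> 'a::metric_space \<Rightarrow> 'a) \<Rightarrow> (nat \<Rightarrow> real) \<Rightarrow> 'a set \<Rightarrow> bool" where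
  "self_similar m f r S \<longleftrightarrow>
     compact S \<and> S \<noteq> {} \<and> (\<forall>i<m. contracting_similarity (r i) (f i)) \<and> S = (\<Union>i<m. f i ` S)"

definition strong_separation :: "nat \<Rightarrow> (nat \<Rightarrow> 'a \<Rightarrow> 'a) \<Rightarrow> 'a set \<Rightarrow> bool" where
  "strong_separation m f S \<longleftrightarrow> (\<forall>i<m. \<forall>j<m. i \<noteq> j \<longrightarrow> f i ` S \<inter> f j ` S = {})"

definition similarity_dim :: "nat \<Rightarrow> (nat \<Rightarrow> real) \<Rightarrow> real" where
  "similarity_dim m r = (THE s. (\<Sum>i<m. r i powr s) = 1)"


section \<open>The Hausdorff metric on nonempty compact sets\<close>

typedef (overloaded) 'a::metric_space compacts = "{K :: 'a set. compact K \<and> K \<noteq> {}}"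
  morphisms set_of_compacts Abs_compacts
  by (rule exI[of _ "{undefined}"]) simp

definition hausdorff_excess :: "'a::metric_space set \<Rightarrow> 'a set \<Rightarrow> real" where
  "hausdorff_excess A B = (SUP x\<in>A. infdist x B)"

lemma compact_set_of_compacts: "compact (set_of_compacts K)"
  and set_of_compacts_nonempty: "set_of_compacts K \<noteq> {}"
  using set_of_compacts[of K] by auto

lemma bdd_above_infdist_compact:
  assumes "compact A"
  shows "bdd_above ((\<lambda>x. infdist x B) ` A)"
  by (intro bounded_imp_bdd_above compact_imp_bounded compact_continuous_image
        continuous_intros assms)

lemma infdist_le_hausdorff_excess:
  assumes "compact A" "x \<in> A"
  shows "infdist x B \<le> hausdorff_excess A B"
  unfolding hausdorff_excess_def
  by (rule cSUP_upper[OF assms(2) bdd_above_infdist_compact[OF assms(1)]])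

lemma hausdorff_excess_nonneg:
  assumes "compact A" "A \<noteq> {}"
  shows "0 \<le> hausdorff_excess A B"
proof -
  obtain x where "x \<in> A" using assms by blast
  then show ?thesis
    using infdist_le_hausdorff_excess[OF assms(1)] infdist_nonneg[of x B] order_trans by blast
qed

lemma hausdorff_excess_self:
  assumes "A \<noteq> {}"
  shows "hausdorff_excess A A = 0"
  using assms by (simp add: hausdorff_excess_def)

lemma hausdorff_excess_le_0_imp_subset:
  assumes "compact A" "closed B" "B \<noteq> {}" "hausdorff_excess A B \<le> 0"
  shows "A \<subseteq> B"
proof
  fix x assume "x \<in> A"
  then have "infdist x B = 0"
    using infdist_le_hausdorff_excess[OF assms(1), of x B] assms(4) infdist_nonneg[of x B] by linarith
  then show "x \<in> B"
    using in_closed_iff_infdist_zero[OF assms(2,3)] by blast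
qed

lemma hausdorff_excess_triangle:
  assumes "A \<noteq> {}" "compact B" "B \<noteq> {}"
    and "compact A"
  shows "hausdorff_excess A C \<le> hausdorff_excess A B + hausdorff_excess B C"
proof -
  have "infdist x C \<le> hausdorff_excess A B + hausdorff_excess B C" if x: "x \<in> A" for x
  proof -
    have "infdist x C - hausdorff_excess B C \<le> dist x y" if "y \<in> B" for y
      using infdist_triangle[of x C y] infdist_le_hausdorff_excess[OF assms(2) that, of C] by linarith
    then have "infdist x C - hausdorff_excess B C \<le> infdist x B"
      unfolding infdist_notempty[OF assms(3)] by (intro cINF_greatest assms(3))
    then show ?thesis
      using infdist_le_hausdorff_excess[OF assms(4) x, of B] by linarith
  qed
  then show ?thesis
    unfolding hausdorff_excess_def[of A C] by (intro cSUP_least assms(1)) auto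
qed

instantiation compacts :: (metric_space) metric_space
begin

definition dist_compacts :: "'a compacts \<Rightarrow> 'a compacts \<Rightarrow> real" where
  "dist_compacts K L =
     max (hausdorff_excess (set_of_compacts K) (set_of_compacts L))
         (hausdorff_excess (set_of_compacts L) (set_of_compacts K))"

definition uniformity_compacts :: "('a compacts \<times> 'a compacts) filter" where
  "uniformity_compacts = (INF e\<in>{0<..}. principal {(x, y). dist x y < e})"

definition open_compacts :: "'a compacts set \<Rightarrow> bool" where
  "open_compacts U \<longleftrightarrow> (\<forall>x\<in>U. \<forall>\<^sub>F (x', y) in uniformity. x' = x \<longrightarrow> y \<in> U)"

instance
proof
  fix K L M :: "'a compacts"
  note c = compact_set_of_compacts set_of_compacts_nonempty
  show "dist K L = 0 \<longleftrightarrow> K = L"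
  proof
    assume "dist K L = 0"
    then have "hausdorff_excess (set_of_compacts K) (set_of_compacts L) \<le> 0"
      and "hausdorff_excess (set_of_compacts L) (set_of_compacts K) \<le> 0"
      by (auto simp: dist_compacts_def max_def split: if_splits)
    then have "set_of_compacts K = set_of_compacts L"
      by (intro subset_antisym hausdorff_excess_le_0_imp_subset c compact_imp_closed)
    then show "K = L"
      by (simp add: set_of_compacts_inject)
  next
    assume "K = L"
    then show "dist K L = 0"
      by (simp add: dist_compacts_def hausdorff_excess_self c)
  qed
  show "dist K L \<le> dist K M + dist L M"
    using hausdorff_excess_triangle[of "set_of_compacts K" "set_of_compacts M" "set_of_compacts L"]
      hausdorff_excess_triangle[of "set_of_compacts L" "set_of_compacts M" "set_of_compacts K"] c
    unfolding dist_compacts_def by (smt (verit))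
qed (simp_all add: uniformity_compacts_def open_compacts_def)

end

end

theory Submission
  imports Defs
begin

text \<open>
  The regularity properties hold for every \<open>D\<close> in the family, because of one feature of Euclidean
  space: a bounded set can be replaced, at the cost of a constant, by balls of a prescribed
  comparable diameter. So the restriction \<open>|E\<^sub>i| \<in> D\<close> on the covering sets can be restored after any
  operation that changes diameters by a bounded factor only.

  For \<open>s > 0\<close> the content is an outer measure (\<open>content_countable_subadditive\<close>, \<open>content_empty\<close>), which
  gives monotonicity and \<open>\<sigma>\<close>-stability of its critical exponent. A Lipschitz map multiplies the content
  by at most a constant (\<open>content_lipschitz_image_null\<close>): the image of a set of diameter \<open>d \<in> D\<close> lies in
  a bounded number of balls of diameter \<open>d\<close>. Sorgenfrey openness lets each covering set be
  enlarged to an open one of admissible diameter, so that \<open>K \<mapsto> content_D D s K\<close> is upper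
  semicontinuous in the Hausdorff metric, whence Borel measurability
  (\<open>dim_D_compacts_borel_measurable\<close>).

  The dimension is at most any exponent \<open>s\<close> for which the covering numbers at all small scales
  \<open>\<rho>\<close> are \<open>O(\<rho>\<^sup>-\<^sup>s)\<close> (\<open>dim_D_le_box_dimension\<close>); lower bounds come from a mass distribution principle
  on trees (\<open>content_ge_tree_mass\<close>), in which only the diameters in \<open>D\<close> have to be compared with the
  masses. For a self-similar set with strong separation both bounds give the similarity dimension.

  To produce different dimensions, take the set of all \<open>\<Sum>\<^sub>j b\<^sub>j 4\<^sup>-\<^sup>j\<close> with digits \<open>b\<^sub>j \<in> {0, 1}\<close> that vanish
  outside the blocks \<open>k! \<le> j < 2 k!\<close>, placed on a coordinate axis. At the scale \<open>4 powr (- x * k!)\<close>,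
  where \<open>1 < x \<le> 2\<close>, about \<open>(x - 1) k!\<close> binary digits are free; the earlier blocks only
  have total length \<open>o(k!)\<close>. If \<open>D\<close> consists of these scales only, each thickened by a factor
  \<open>2\<close> so as to be Sorgenfrey open, the dimension of the set is therefore \<open>(x - 1) / (2 x)\<close>
  (\<open>dim_D_factorial_cantor_set\<close>). This is strictly increasing in \<open>x\<close>, so different \<open>x\<close> give different
  dimensions; and since the Hausdorff dimension is at most \<open>dim_D D\<close> for every \<open>D\<close>, on this set it is
  strictly below the value for each \<open>x\<close>, because it is at most the value for a smaller one.
\<close>

section \<open>The content as an outer measure\<close>

lemma sorgenfrey_family_pos: "D \<in> sorgenfrey_family \<Longrightarrow> d \<in> D \<Longrightarrow> 0 < d"
  by (auto simp: sorgenfrey_family_def)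

lemma sorgenfrey_family_small:
  assumes "D \<in> sorgenfrey_family" "0 < e"
  obtains d where "d \<in> D" "0 < d" "d < e"
proof -
  have "\<exists>d\<in>D. d < e"
    using assms cInf_lessD[of D e] by (auto simp: sorgenfrey_family_def)
  then show thesis
    using that sorgenfrey_family_pos[OF assms(1)] by blast
qed

lemma ennreal_zeroI: "(\<And>e. 0 < e \<Longrightarrow> x \<le> ennreal e) \<Longrightarrow> x = 0"
  by (metis ennreal_le_epsilon add.left_neutral le_zero_eq)

lemma content_le_cover:
  assumes "A \<subseteq> (\<Union>i. E i)" "\<And>i. bounded (E i)" "\<And>i. diameter (E i) \<in> D"
  shows "content_D D s A \<le> (\<Sum>i. ennreal (diameter (E i) powr s))"
  unfolding content_D_def using assms by (intro Inf_lower) auto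

lemma content_less_cover:
  assumes "content_D D s A < c"
  obtains E where "A \<subseteq> (\<Union>i. E i)" "\<And>i. bounded (E i)" "\<And>i. diameter (E i) \<in> D"
    "(\<Sum>i. ennreal (diameter (E i) powr s)) < c"
  using assms unfolding content_D_def Inf_less_iff by blast

lemma content_mono: "A \<subseteq> B \<Longrightarrow> content_D D s A \<le> content_D D s B"
  unfolding content_D_def by (intro Inf_superset_mono) blast

lemma suminf_ennreal_geometric: "0 \<le> c \<Longrightarrow> (\<Sum>i. ennreal (c * (1 / 2) ^ Suc i)) = ennreal c"
  using sums_mult[OF power_half_series, of c] by (intro suminf_ennreal_eq) auto

lemma content_countable_subadditive:
  fixes A :: "nat \<Rightarrow> 'a::metric_space set"
  shows "content_D D s (\<Union>i. A i) \<le> (\<Sum>i. content_D D s (A i))"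
proof (rule ennreal_le_epsilon)
  fix e :: real
  assume fin: "(\<Sum>i. content_D D s (A i)) < top" and "0 < e"
  have "content_D D s (A i) < content_D D s (A i) + ennreal (e * (1 / 2) ^ Suc i)" for i
    using ennreal_suminf_lessD[OF fin, of i] \<open>0 < e\<close>
      ennreal_add_left_cancel_less[of "content_D D s (A i)" 0 "ennreal (e * (1 / 2) ^ Suc i)"]
    by (simp add: less_top)
  then have "\<exists>E. A i \<subseteq> (\<Union>j. E j) \<and> (\<forall>j. bounded (E j) \<and> diameter (E j) \<in> D) \<and>
      (\<Sum>j. ennreal (diameter (E j) powr s)) < content_D D s (A i) + ennreal (e * (1 / 2) ^ Suc i)" for i
    by (rule content_less_cover) blast
  then obtain E where E: "A i \<subseteq> (\<Union>j. E i j)" "bounded (E i j)" "diameter (E i j) \<in> D"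
      "(\<Sum>j. ennreal (diameter (E i j) powr s)) < content_D D s (A i) + ennreal (e * (1 / 2) ^ Suc i)"
    for i j by metis
  let ?F = "\<lambda>k. case prod_decode k of (i, j) \<Rightarrow> E i j"
  have "(\<Union>i. A i) \<subseteq> (\<Union>k. ?F k)"
  proof
    fix x assume "x \<in> (\<Union>i. A i)"
    then obtain i j where "x \<in> E i j" using E(1) by blast
    then have "x \<in> ?F (prod_encode (i, j))" by simp
    then show "x \<in> (\<Union>k. ?F k)" by (rule UN_I[OF UNIV_I])
  qed
  then have "content_D D s (\<Union>i. A i) \<le> (\<Sum>k. ennreal (diameter (?F k) powr s))"
    using E by (intro content_le_cover) (auto split: prod.split)
  also have "\<dots> = (\<Sum>k. (\<lambda>p. ennreal (diameter (E (fst p) (snd p)) powr s)) (prod_decode k))"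
    by (simp add: case_prod_beta)
  also have "\<dots> = (\<Sum>i. \<Sum>j. ennreal (diameter (E i j) powr s))"
    by (rule suminf_ennreal_2dimen) simp
  also have "\<dots> \<le> (\<Sum>i. content_D D s (A i) + ennreal (e * (1 / 2) ^ Suc i))"
    using E(4) by (intro suminf_le) (auto intro: less_imp_le)
  also have "\<dots> = (\<Sum>i. content_D D s (A i)) + (\<Sum>i. ennreal (e * (1 / 2) ^ Suc i))"
    by (intro suminf_add[symmetric]) auto
  also have "(\<Sum>i. ennreal (e * (1 / 2) ^ Suc i)) = ennreal e"
    using \<open>0 < e\<close> by (intro suminf_ennreal_geometric) simp
  finally show "content_D D s (\<Union>i. A i) \<le> (\<Sum>i. content_D D s (A i)) + ennreal e" .
qed

lemma powr_small:
  assumes "0 < s" "0 < e"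
  obtains c :: real where "0 < c" "\<And>d. 0 < d \<Longrightarrow> d < c \<Longrightarrow> d powr s < e"
proof
  show "0 < e powr (1 / s)" using assms by simp
  fix d :: real assume "0 < d" "d < e powr (1 / s)"
  then have "d powr s < (e powr (1 / s)) powr s" using assms by (intro powr_less_mono2) auto
  then show "d powr s < e" using assms by (simp add: powr_powr)
qed

text \<open>
  The set itself is a cover, except that a cover is an infinite sequence of sets of positive
  diameter. Balls whose diameters \<open>d\<^sub>i \<in> D\<close> satisfy \<open>d\<^sub>i powr s < e / 2\<^sup>i\<^sup>+\<^sup>1\<close> fill it up; they exist because
  \<open>inf D = 0\<close> and \<open>s > 0\<close>.
\<close>

lemma content_le_diameter:
  fixes A :: "'a::euclidean_space set"
  assumes D: "D \<in> sorgenfrey_family" and s: "0 < s"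
    and A: "bounded A" "diameter A \<in> D"
  shows "content_D D s A \<le> ennreal (diameter A powr s)"
proof (rule ennreal_le_epsilon)
  fix e :: real assume "0 < e"
  have "\<exists>d. d \<in> D \<and> 0 < d \<and> d powr s < e * (1 / 2) ^ Suc i" for i
  proof -
    obtain c where c: "0 < c" "\<And>d. 0 < d \<Longrightarrow> d < c \<Longrightarrow> d powr s < e * (1 / 2) ^ Suc i"
      using powr_small[OF s, of "e * (1 / 2) ^ Suc i"] \<open>0 < e\<close> by auto
    show ?thesis using sorgenfrey_family_small[OF D c(1)] c(2) by metis
  qed
  then obtain d where d: "d i \<in> D" "0 < d i" "d i powr s < e * (1 / 2) ^ Suc i" for i
    by metis
  let ?E = "\<lambda>i. case i of 0 \<Rightarrow> A | Suc j \<Rightarrow> cball 0 (d j / 2)"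
  have "A \<subseteq> (\<Union>i. ?E i)" by (auto intro: UN_I[of 0])
  moreover have "bounded (?E i)" "diameter (?E i) \<in> D" for i
    using A d(1) less_not_sym[OF d(2)] by (auto split: nat.split)
  ultimately have "content_D D s A \<le> (\<Sum>i. ennreal (diameter (?E i) powr s))"
    by (intro content_le_cover) auto
  also have "\<dots> = (\<Sum>i. ennreal (diameter (?E (Suc i)) powr s)) + ennreal (diameter (?E 0) powr s)"
    by (subst suminf_offset[OF summableI, of _ 1]) simp
  also have "(\<Sum>i. ennreal (diameter (?E (Suc i)) powr s)) \<le> (\<Sum>i. ennreal (e * (1 / 2) ^ Suc i))"
    using d(3) less_not_sym[OF d(2)] by (intro suminf_le ennreal_leI) (auto simp: less_imp_le)
  also have "(\<Sum>i. ennreal (e * (1 / 2) ^ Suc i)) = ennreal e"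
    using \<open>0 < e\<close> by (intro suminf_ennreal_geometric) simp
  finally show "content_D D s A \<le> ennreal (diameter A powr s) + ennreal e"
    by (simp add: add.commute add_mono)
qed

lemma content_empty:
  fixes D :: "real set"
  assumes D: "D \<in> sorgenfrey_family" and s: "0 < s"
  shows "content_D D s ({} :: 'a::euclidean_space set) = 0"
proof -
  have "content_D D s ({} :: 'a set) \<le> ennreal e" if "0 < e" for e
  proof -
    obtain c where c: "0 < c" "\<And>d. 0 < d \<Longrightarrow> d < c \<Longrightarrow> d powr s < e"
      using powr_small[OF s \<open>0 < e\<close>] by auto
    obtain d where d: "d \<in> D" "0 < d" "d < c" using sorgenfrey_family_small[OF D c(1)] .
    have "content_D D s ({} :: 'a set) \<le> content_D D s (cball (0::'a) (d / 2))"
      by (intro content_mono) simp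
    also have "\<dots> \<le> ennreal (diameter (cball (0::'a) (d / 2)) powr s)"
      using d by (intro content_le_diameter D s) auto
    also have "\<dots> \<le> ennreal e"
      using d c(2)[of d] by (intro ennreal_leI) auto
    finally show ?thesis .
  qed
  then show ?thesis
    by (rule ennreal_zeroI)
qed

lemma content_finite_subadditive:
  fixes A :: "'b \<Rightarrow> 'a::euclidean_space set"
  assumes D: "D \<in> sorgenfrey_family" and s: "0 < s" and "finite I"
  shows "content_D D s (\<Union>i\<in>I. A i) \<le> (\<Sum>i\<in>I. content_D D s (A i))"
  using \<open>finite I\<close>
proof induction
  case empty
  then show ?case using content_empty[OF D s] by simp
next
  case (insert a I)
  let ?B = "\<lambda>i::nat. if i = 0 then A a else if i = 1 then (\<Union>i\<in>I. A i) else {}"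
  have "(\<Union>i\<in>insert a I. A i) = (\<Union>i. ?B i)"
    by (auto split: if_splits)
  then have "content_D D s (\<Union>i\<in>insert a I. A i) \<le> (\<Sum>i. content_D D s (?B i))"
    by (simp only: content_countable_subadditive)
  also have "\<dots> = (\<Sum>i\<in>{0, 1}. content_D D s (?B i))"
    by (intro suminf_finite) (auto simp: content_empty[OF D s])
  also have "\<dots> \<le> content_D D s (A a) + (\<Sum>i\<in>I. content_D D s (A i))"
    using insert.IH by (simp add: add_left_mono)
  finally show ?case using insert.hyps by simp
qed

text \<open>
  Balls of a common radius \<open>d / 2\<close> have diameter exactly \<open>d\<close> in a Euclidean space, so for \<open>d \<in> D\<close>
  a bound on the covering number at this scale bounds the content. The bound \<open>N\<close> is real so that
  it can be of the form \<open>C * \<rho> powr - s\<close>.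
\<close>

definition ball_coverable :: "'a::metric_space set \<Rightarrow> real \<Rightarrow> real \<Rightarrow> bool" where
  "ball_coverable A \<rho> N \<longleftrightarrow>
     (\<exists>T. finite T \<and> real (card T) \<le> N \<and> A \<subseteq> (\<Union>t\<in>T. cball t \<rho>))"

lemma content_le_ball_coverable:
  fixes A :: "'a::euclidean_space set"
  assumes D: "D \<in> sorgenfrey_family" and s: "0 < s" and d: "d \<in> D"
    and A: "ball_coverable A (d / 2) N"
  shows "content_D D s A \<le> ennreal (N * d powr s)"
proof -
  have "0 < d" using D d by (rule sorgenfrey_family_pos)
  obtain T where T: "finite T" "real (card T) \<le> N" "A \<subseteq> (\<Union>t\<in>T. cball t (d / 2))"
    using A by (auto simp: ball_coverable_def)
  have "content_D D s A \<le> content_D D s (\<Union>t\<in>T. cball t (d / 2))"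
    by (rule content_mono[OF T(3)])
  also have "\<dots> \<le> (\<Sum>t\<in>T. content_D D s (cball t (d / 2)))"
    by (rule content_finite_subadditive[OF D s T(1)])
  also have "\<dots> \<le> (\<Sum>t\<in>T. ennreal (d powr s))"
    using content_le_diameter[OF D s, of "cball t (d / 2)" for t] d \<open>0 < d\<close>
    by (intro sum_mono) auto
  also have "\<dots> = ennreal (real (card T) * d powr s)"
    by (simp add: ennreal_mult' ennreal_of_nat_eq_real_of_nat)
  also have "\<dots> \<le> ennreal (N * d powr s)"
    using T(2) by (intro ennreal_leI mult_right_mono) auto
  finally show ?thesis .
qed

text \<open>
  A cube of side \<open>\<rho> / DIM('a)\<close> has \<open>\<ell>\<^sup>1\<close>-diameter \<open>\<rho>\<close>, so it lies in the ball of radius \<open>\<rho>\<close> about its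
  lowest corner; the corners of a grid of such cubes that come within reach of \<open>A\<close> are indexed by the
  integer vectors with entries in \<open>{- M..M}\<close>.
\<close>

lemma ball_coverable_bounded:
  fixes A :: "'a::euclidean_space set"
  assumes A: "A \<subseteq> cball a R" and "0 \<le> R" "0 < \<rho>"
  shows "ball_coverable A \<rho> ((2 * real DIM('a) * R / \<rho> + 3) ^ DIM('a))"
proof -
  define \<eta> where "\<eta> = \<rho> / DIM('a)"
  have \<eta>: "0 < \<eta>" using \<open>0 < \<rho>\<close> by (simp add: \<eta>_def)
  define M where "M = nat \<lfloor>R / \<eta>\<rfloor> + 1"
  define Z where "Z = (\<Pi>\<^sub>E b\<in>(Basis::'a set). {- int M .. int M})"
  define c where "c = (\<lambda>z. a + (\<Sum>b\<in>(Basis::'a set). (\<eta> * of_int (z b)) *\<^sub>R b))"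
  have "finite Z" unfolding Z_def by (intro finite_PiE) auto
  have cardZ: "card Z = (2 * M + 1) ^ DIM('a)"
    unfolding Z_def by (subst card_PiE) (auto simp: nat_add_distrib nat_mult_distrib)
  have M: "R / \<eta> < M" "real M \<le> R / \<eta> + 1"
  proof -
    have "0 \<le> R / \<eta>" using \<open>0 \<le> R\<close> \<eta> by simp
    then show "R / \<eta> < M" "real M \<le> R / \<eta> + 1" unfolding M_def by linarith+
  qed
  have "A \<subseteq> (\<Union>t\<in>c ` Z. cball t \<rho>)"
  proof
    fix x assume "x \<in> A"
    then have xa: "norm (x - a) \<le> R" using A by (auto simp: dist_norm norm_minus_commute)
    define z where "z = restrict (\<lambda>b. \<lfloor>((x - a) \<bullet> b) / \<eta>\<rfloor>) (Basis::'a set)"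
    have floor_bound: "\<bar>((x - a) \<bullet> b) / \<eta>\<bar> < M" if "b \<in> Basis" for b
    proof -
      have "\<bar>(x - a) \<bullet> b\<bar> \<le> R" using Basis_le_norm[OF that, of "x - a"] xa by linarith
      then have "\<bar>((x - a) \<bullet> b) / \<eta>\<bar> \<le> R / \<eta>" using \<eta> by (simp add: divide_right_mono)
      then show ?thesis using M(1) by linarith
    qed
    have "z b \<in> {- int M .. int M}" if "b \<in> Basis" for b
      using floor_bound[OF that] that unfolding z_def abs_less_iff atLeastAtMost_iff
      by (simp add: le_floor_iff floor_le_iff)
    then have "z \<in> Z" unfolding Z_def z_def by auto
    have "dist x (c z) \<le> (\<Sum>b\<in>(Basis::'a set). \<bar>(x - c z) \<bullet> b\<bar>)"
      unfolding dist_norm by (rule norm_le_l1)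
    also have "\<dots> \<le> (\<Sum>b\<in>(Basis::'a set). \<eta>)"
    proof (rule sum_mono)
      fix b :: 'a assume b: "b \<in> Basis"
      have "(x - c z) \<bullet> b = (x - a) \<bullet> b - \<eta> * \<lfloor>((x - a) \<bullet> b) / \<eta>\<rfloor>"
        using b by (simp add: c_def z_def inner_diff_left inner_add_left algebra_simps)
      also have "\<dots> = \<eta> * (((x - a) \<bullet> b) / \<eta> - \<lfloor>((x - a) \<bullet> b) / \<eta>\<rfloor>)"
        using \<eta> by (simp add: field_simps)
      finally have "\<bar>(x - c z) \<bullet> b\<bar> = \<eta> * \<bar>((x - a) \<bullet> b) / \<eta> - \<lfloor>((x - a) \<bullet> b) / \<eta>\<rfloor>\<bar>"
        using \<eta> by (simp add: abs_mult)
      also have "\<dots> \<le> \<eta> * 1"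
        using \<eta> by (intro mult_left_mono) linarith+
      finally show "\<bar>(x - c z) \<bullet> b\<bar> \<le> \<eta>" by simp
    qed
    also have "\<dots> = \<rho>" by (simp add: \<eta>_def)
    finally show "x \<in> (\<Union>t\<in>c ` Z. cball t \<rho>)" using \<open>z \<in> Z\<close> by (auto simp: dist_commute)
  qed
  moreover have "real (card (c ` Z)) \<le> (2 * real DIM('a) * R / \<rho> + 3) ^ DIM('a)"
  proof -
    have "real (card (c ` Z)) \<le> real (card Z)"
      using card_image_le[OF \<open>finite Z\<close>] by simp
    also have "\<dots> = (2 * real M + 1) ^ DIM('a)" by (simp add: cardZ add.commute)
    also have "\<dots> \<le> (2 * (R / \<eta>) + 3) ^ DIM('a)"
      using M(2) by (intro power_mono) auto
    finally show ?thesis by (simp add: \<eta>_def mult_ac)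
  qed
  ultimately show ?thesis
    unfolding ball_coverable_def using \<open>finite Z\<close> by blast
qed

text \<open>
  If \<open>E\<close> has diameter \<open>d \<in> D\<close>, then the image of \<open>A \<inter> E\<close> lies in a ball of radius \<open>C * d\<close> and hence in a
  number \<open>K\<close> of balls of diameter \<open>d\<close> that depends on \<open>C\<close> and the dimension only. Thus every diameter in a
  cover of \<open>A\<close> can be kept, which keeps it in \<open>D\<close>.
\<close>

lemma content_lipschitz_image_null:
  fixes f :: "'a::metric_space \<Rightarrow> 'b::euclidean_space"
  assumes D: "D \<in> sorgenfrey_family" and s: "0 < s" and f: "C-lipschitz_on A f"
    and null: "content_D D s A = 0"
  shows "content_D D s (f ` A) = 0"
proof -
  have C: "0 \<le> C" using f by (rule lipschitz_on_nonneg)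
  define K where "K = (2 * real DIM('b) * (2 * C) + 3) ^ DIM('b)"
  have K: "0 < K" unfolding K_def using C by (intro zero_less_power add_nonneg_pos) auto
  have image: "content_D D s (f ` (A \<inter> E)) \<le> ennreal K * ennreal (diameter E powr s)"
    if E: "bounded E" "diameter E \<in> D" for E
  proof (cases "A \<inter> E = {}")
    case True
    then show ?thesis by (simp add: content_empty[OF D s])
  next
    case False
    then obtain x where x: "x \<in> A" "x \<in> E" by blast
    have pos: "0 < diameter E" using D E(2) by (rule sorgenfrey_family_pos)
    have "f ` (A \<inter> E) \<subseteq> cball (f x) (C * diameter E)"
    proof clarsimp
      fix y assume "y \<in> A" "y \<in> E"
      then have "dist (f x) (f y) \<le> C * dist x y" using x by (intro lipschitz_onD[OF f])
      also have "\<dots> \<le> C * diameter E"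
        using C x \<open>y \<in> E\<close> E(1) by (intro mult_left_mono diameter_bounded_bound)
      finally show "dist (f x) (f y) \<le> C * diameter E" .
    qed
    from ball_coverable_bounded[OF this, of "diameter E / 2"]
    have "ball_coverable (f ` (A \<inter> E)) (diameter E / 2) K"
      using C pos by (simp add: K_def mult.commute mult.left_commute)
    from content_le_ball_coverable[OF D s E(2) this] show ?thesis
      using K by (simp add: ennreal_mult')
  qed
  have "content_D D s (f ` A) \<le> ennreal e" if "0 < e" for e
  proof -
    have "content_D D s A < ennreal (e / K)" using null that K by simp
    then obtain E where E: "A \<subseteq> (\<Union>i. E i)" "\<And>i. bounded (E i)" "\<And>i. diameter (E i) \<in> D"
      "(\<Sum>i. ennreal (diameter (E i) powr s)) < ennreal (e / K)"
      by (rule content_less_cover) blast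
    have "content_D D s (f ` A) \<le> content_D D s (\<Union>i. f ` (A \<inter> E i))"
      using E(1) by (intro content_mono) blast
    also have "\<dots> \<le> (\<Sum>i. content_D D s (f ` (A \<inter> E i)))"
      by (rule content_countable_subadditive)
    also have "\<dots> \<le> (\<Sum>i. ennreal K * ennreal (diameter (E i) powr s))"
      using E by (intro suminf_le image) auto
    also have "\<dots> = ennreal K * (\<Sum>i. ennreal (diameter (E i) powr s))" by simp
    also have "\<dots> \<le> ennreal K * ennreal (e / K)"
      using E(4) by (intro mult_left_mono) auto
    also have "\<dots> = ennreal e" using K that by (simp flip: ennreal_mult)
    finally show ?thesis .
  qed
  then show ?thesis
    by (rule ennreal_zeroI)
qed

text \<open>
  In a cover with \<open>\<Sum>d\<^sub>i powr s < 1\<close> all diameters are at most \<open>1\<close>, and then raising the exponent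
  decreases the sum.
\<close>

lemma content_zero_mono:
  assumes D: "D \<in> sorgenfrey_family" and "0 < s" "s \<le> t" and null: "content_D D s A = 0"
  shows "content_D D t A = 0"
proof -
  have "content_D D t A \<le> ennreal e" if "0 < e" for e
  proof -
    have "content_D D s A < ennreal (min e 1)" using null that by simp
    then obtain E where E: "A \<subseteq> (\<Union>i. E i)" "\<And>i. bounded (E i)" "\<And>i. diameter (E i) \<in> D"
      "(\<Sum>i. ennreal (diameter (E i) powr s)) < ennreal (min e 1)"
      by (rule content_less_cover) blast
    have "diameter (E i) powr t \<le> diameter (E i) powr s" for i
    proof -
      have "0 < diameter (E i)" using D E(3) by (rule sorgenfrey_family_pos)
      have "ennreal (diameter (E i) powr s) < ennreal (min e 1)"
        using E(4) by (rule ennreal_suminf_lessD)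
      then have "diameter (E i) powr s \<le> 1" by (simp add: ennreal_less_iff)
      then have "diameter (E i) \<le> 1"
        using powr_less_mono2[of s 1 "diameter (E i)"] \<open>0 < s\<close> by fastforce
      then show ?thesis using \<open>0 < diameter (E i)\<close> \<open>s \<le> t\<close> by (simp add: powr_mono')
    qed
    then have "(\<Sum>i. ennreal (diameter (E i) powr t)) \<le> (\<Sum>i. ennreal (diameter (E i) powr s))"
      by (intro suminf_le ennreal_leI) auto
    also have "\<dots> \<le> ennreal e" using E(4) by (smt (verit) ennreal_leI min.cobounded1 order_less_imp_le order_trans)
    finally show ?thesis using content_le_cover[OF E(1-3)] by (rule order_trans[rotated])
  qed
  then show ?thesis
    by (rule ennreal_zeroI)
qed

text \<open>
  Every set of an admissible cover contributes \<open>1\<close>. So only positive exponents, for which the content is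
  an outer measure, are relevant to the dimension.
\<close>

lemma content_at_0_nonzero:
  assumes "D \<in> sorgenfrey_family"
  shows "content_D D 0 A \<noteq> 0"
proof
  assume "content_D D 0 A = 0"
  then have "content_D D 0 A < 1" by simp
  then obtain E :: "nat \<Rightarrow> 'a set" where E: "\<And>i. diameter (E i) \<in> D"
      "(\<Sum>i. ennreal (diameter (E i) powr 0)) < 1"
    by (rule content_less_cover) blast
  have "ennreal (diameter (E 0) powr 0) < 1"
    using E(2) by (rule ennreal_suminf_lessD)
  then show False using sorgenfrey_family_pos[OF assms E(1)[of 0]] by simp
qed

section \<open>Properties shared by all the dimensions\<close>

lemma dim_D_nonneg: "0 \<le> dim_D D A"
  unfolding dim_D_def by (intro Inf_greatest) auto

lemma dim_D_le: "0 \<le> s \<Longrightarrow> content_D D s A = 0 \<Longrightarrow> dim_D D A \<le> ereal s"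
  unfolding dim_D_def by (intro Inf_lower) auto

lemma dim_D_less_iff:
  assumes D: "D \<in> sorgenfrey_family"
  shows "dim_D D A < a \<longleftrightarrow> (\<exists>s>0. ereal s < a \<and> content_D D s A = 0)"
proof -
  have "dim_D D A < a \<longleftrightarrow> (\<exists>s\<ge>0. ereal s < a \<and> content_D D s A = 0)"
    unfolding dim_D_def Inf_less_iff by blast
  also have "\<dots> \<longleftrightarrow> (\<exists>s>0. ereal s < a \<and> content_D D s A = 0)"
    using content_at_0_nonzero[OF D] by (metis less_eq_real_def)
  finally show ?thesis .
qed

lemma content_zero_above_dim_D:
  assumes D: "D \<in> sorgenfrey_family" and "dim_D D A < ereal s"
  shows "content_D D s A = 0"
  using assms content_zero_mono[OF D] unfolding dim_D_less_iff[OF D]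
  by (metis ereal_less_eq(3) less_imp_le)

lemma dim_D_ge:
  assumes D: "D \<in> sorgenfrey_family" and "content_D D s A \<noteq> 0"
  shows "ereal s \<le> dim_D D A"
  using content_zero_above_dim_D[OF D] assms(2) not_le by blast

lemma dim_D_mono: "A \<subseteq> B \<Longrightarrow> dim_D D A \<le> dim_D D B"
  unfolding dim_D_def
  by (intro Inf_superset_mono Collect_mono) (metis content_mono le_zero_eq)

lemma dim_D_countable_union:
  fixes A :: "nat \<Rightarrow> 'a::metric_space set"
  assumes D: "D \<in> sorgenfrey_family"
  shows "dim_D D (\<Union>i. A i) = (SUP i. dim_D D (A i))"
proof (rule antisym)
  show "(SUP i. dim_D D (A i)) \<le> dim_D D (\<Union>i. A i)"
    by (intro SUP_least dim_D_mono) blast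
  show "dim_D D (\<Union>i. A i) \<le> (SUP i. dim_D D (A i))"
  proof (rule dense_ge)
    fix a assume "(SUP i. dim_D D (A i)) < a"
    then obtain s where s: "(SUP i. dim_D D (A i)) < ereal s" "ereal s < a"
      using ereal_dense2 by blast
    have "dim_D D (A i) < ereal s" for i
      using s(1) by (meson SUP_upper UNIV_I le_less_trans)
    then have "content_D D s (A i) = 0" for i
      by (rule content_zero_above_dim_D[OF D])
    then have "content_D D s (\<Union>i. A i) = 0"
      using content_countable_subadditive[of D s A] by simp
    moreover have "0 \<le> ereal s"
      using dim_D_nonneg[of D "A 0"] \<open>dim_D D (A 0) < ereal s\<close> by (meson le_less_trans less_imp_le)
    ultimately show "dim_D D (\<Union>i. A i) \<le> a"
      using dim_D_le[of s] s(2) by (meson ereal_less_eq(5) less_imp_le order_trans)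
  qed
qed

lemma dim_D_union:
  assumes D: "D \<in> sorgenfrey_family"
  shows "dim_D D (A \<union> B) = max (dim_D D A) (dim_D D B)"
proof -
  have "dim_D D (A \<union> B) = (SUP i. dim_D D (binary A B i))"
    unfolding Un_range_binary by (rule dim_D_countable_union[OF D])
  also have "\<dots> = Sup (dim_D D ` range (binary A B))"
    by (simp add: image_comp)
  also have "\<dots> = max (dim_D D A) (dim_D D B)"
    by (simp add: range_binary_eq sup_max)
  finally show ?thesis .
qed

lemma dim_D_lipschitz_image_le:
  fixes f :: "'a::metric_space \<Rightarrow> 'b::euclidean_space"
  assumes D: "D \<in> sorgenfrey_family" and f: "C-lipschitz_on A f"
  shows "dim_D D (f ` A) \<le> dim_D D A"
proof (rule dense_ge)
  fix a assume "dim_D D A < a"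
  then obtain s where "0 < s" "ereal s < a" "content_D D s A = 0"
    unfolding dim_D_less_iff[OF D] by blast
  then show "dim_D D (f ` A) \<le> a"
    using dim_D_le[OF _ content_lipschitz_image_null[OF D _ f]] by (meson less_imp_le order_trans)
qed

lemma dim_D_bilipschitz_eq:
  fixes A :: "'a::euclidean_space set" and B :: "'b::euclidean_space set"
  assumes D: "D \<in> sorgenfrey_family" and "bilipschitz_equivalent A B"
  shows "dim_D D A = dim_D D B"
proof -
  obtain f C C' where f: "bij_betw f A B" "C-lipschitz_on A f" "C'-lipschitz_on B (inv_into A f)"
    using assms(2) unfolding bilipschitz_equivalent_def by blast
  have im: "f ` A = B" "inv_into A f ` B = A"
    using bij_betw_imp_surj_on[OF f(1)] bij_betw_imp_surj_on[OF bij_betw_inv_into[OF f(1)]] .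
  show ?thesis
    using dim_D_lipschitz_image_le[OF D f(2)] dim_D_lipschitz_image_le[OF D f(3)]
    unfolding im by (rule antisym[rotated])
qed

text \<open>
  For an upper bound on the dimension it suffices to use one well-chosen scale of \<open>D\<close> at a time. The scale
  may depend on the error \<open>e\<close>, so that estimates at a sparse sequence of scales are enough.
\<close>

lemma content_zero_by_equal_balls:
  fixes A :: "'a::euclidean_space set"
  assumes D: "D \<in> sorgenfrey_family" and s: "0 < s"
    and cov: "\<And>e. 0 < e \<Longrightarrow> \<exists>d\<in>D. \<exists>N. ball_coverable A (d / 2) N \<and> N * d powr s \<le> e"
  shows "content_D D s A = 0"
proof (rule ennreal_zeroI)
  fix e :: real assume "0 < e"
  then obtain d N where "d \<in> D" "ball_coverable A (d / 2) N" "N * d powr s \<le> e"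
    using cov by blast
  then show "content_D D s A \<le> ennreal e"
    using content_le_ball_coverable[OF D s, of d A N] ennreal_leI by (meson order_trans)
qed

text \<open>
  At a scale \<open>d \<in> D\<close> the covering sum is at most a constant times \<open>d powr (t - s)\<close>, and \<open>D\<close> has elements
  arbitrarily close to \<open>0\<close>.
\<close>

lemma dim_D_le_box_dimension:
  fixes A :: "'a::euclidean_space set"
  assumes D: "D \<in> sorgenfrey_family" and "0 \<le> s" "0 < \<rho>\<^sub>0"
    and cov: "\<And>\<rho>. 0 < \<rho> \<Longrightarrow> \<rho> < \<rho>\<^sub>0 \<Longrightarrow> ball_coverable A \<rho> (C * \<rho> powr - s)"
  shows "dim_D D A \<le> ereal s"
proof (rule dense_ge)
  fix a assume "ereal s < a"
  then obtain t where t: "s < t" "ereal t < a"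
    using ereal_dense2 by force
  define K where "K = \<bar>C\<bar> * (1 / 2) powr - s + 1"
  have "0 < K" unfolding K_def by (intro add_nonneg_pos) auto
  have "content_D D t A = 0"
  proof (rule content_zero_by_equal_balls[OF D])
    show "0 < t" using t(1) \<open>0 \<le> s\<close> by simp
    fix e :: real assume "0 < e"
    obtain c where c: "0 < c" "\<And>d. 0 < d \<Longrightarrow> d < c \<Longrightarrow> d powr (t - s) < e / K"
      using powr_small[of "t - s" "e / K"] t(1) \<open>0 < K\<close> \<open>0 < e\<close> by auto
    obtain d where d: "d \<in> D" "0 < d" "d < min c \<rho>\<^sub>0"
      using sorgenfrey_family_small[OF D, of "min c \<rho>\<^sub>0"] c(1) \<open>0 < \<rho>\<^sub>0\<close> by auto
    have "C * (d / 2) powr - s * d powr t \<le> \<bar>C\<bar> * (d / 2) powr - s * d powr t"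
      by (intro mult_right_mono) auto
    also have "\<dots> = \<bar>C\<bar> * (1 / 2) powr - s * d powr (t - s)"
      using d(2) by (simp add: powr_divide powr_minus powr_diff divide_simps)
    also have "\<dots> \<le> K * d powr (t - s)"
      unfolding K_def by (intro mult_right_mono) auto
    also have "\<dots> \<le> K * (e / K)"
      using c(2)[of d] d \<open>0 < K\<close> by (intro mult_left_mono) auto
    also have "\<dots> = e" using \<open>0 < K\<close> by simp
    finally have "C * (d / 2) powr - s * d powr t \<le> e" .
    moreover have "ball_coverable A (d / 2) (C * (d / 2) powr - s)"
      using d by (intro cov) auto
    ultimately show "\<exists>d\<in>D. \<exists>N. ball_coverable A (d / 2) N \<and> N * d powr t \<le> e"
      using d(1) by blast
  qed
  then have "dim_D D A \<le> ereal t"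
    using t(1) \<open>0 \<le> s\<close> by (intro dim_D_le) auto
  then show "dim_D D A \<le> a" using t(2) by simp
qed

lemma dim_D_le_dimension:
  fixes A :: "'a::euclidean_space set"
  assumes D: "D \<in> sorgenfrey_family"
  shows "dim_D D A \<le> ereal (DIM('a))"
proof -
  have ball: "dim_D D (cball (0::'a) (real k)) \<le> ereal (DIM('a))" for k
  proof (rule dim_D_le_box_dimension[OF D, where \<rho>\<^sub>0 = 1])
    fix \<rho> :: real assume \<rho>: "0 < \<rho>" "\<rho> < 1"
    define n where "n = DIM('a)"
    have "(2 * real n * real k / \<rho> + 3) ^ n \<le> ((2 * real n * real k + 3) / \<rho>) ^ n"
      using \<rho> by (intro power_mono) (auto simp: field_simps)
    also have "\<dots> = (2 * real n * real k + 3) ^ n * \<rho> powr - real n"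
      using \<rho> by (simp add: power_mult_distrib power_inverse powr_minus powr_realpow divide_inverse)
    finally show "ball_coverable (cball (0::'a) (real k)) \<rho>
        ((2 * real DIM('a) * real k + 3) ^ DIM('a) * \<rho> powr - real DIM('a))"
      using ball_coverable_bounded[OF order_refl, of "real k" \<rho> "0::'a"] \<rho>
      unfolding ball_coverable_def n_def by (meson of_nat_0_le_iff order_trans)
  qed auto
  have "dim_D D A \<le> dim_D D (\<Union>k::nat. cball (0::'a) (real k))"
    by (intro dim_D_mono) (auto simp: real_arch_simple)
  also have "\<dots> \<le> ereal (DIM('a))"
    unfolding dim_D_countable_union[OF D] by (intro SUP_least ball)
  finally show ?thesis .
qed

text \<open>
  A small sum \<open>\<Sum>d\<^sub>i powr s\<close> forces the single diameters to be small, so the admissible covers that show the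
  vanishing of the content also show the vanishing of the Hausdorff measure.
\<close>

lemma hausdorff_dim_le_dim_D:
  fixes A :: "'a::metric_space set"
  assumes D: "D \<in> sorgenfrey_family"
  shows "hausdorff_dim A \<le> dim_D D A"
proof (rule dense_ge)
  fix a assume "dim_D D A < a"
  then obtain s where s: "0 < s" "ereal s < a" "content_D D s A = 0"
    unfolding dim_D_less_iff[OF D] by blast
  have "hausdorff_premeasure \<delta> s A \<le> ennreal e" if "0 < \<delta>" "0 < e" for \<delta> e
  proof -
    have "content_D D s A < ennreal (min e (\<delta> powr s))" using s(3) that by simp
    then obtain E where E: "A \<subseteq> (\<Union>i. E i)" "\<And>i. bounded (E i)" "\<And>i. diameter (E i) \<in> D"
      "(\<Sum>i. ennreal (diameter (E i) powr s)) < ennreal (min e (\<delta> powr s))"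
      by (rule content_less_cover) blast
    have pos: "0 < diameter (E i)" for i
      using D E(3) by (rule sorgenfrey_family_pos)
    have "diameter (E i) \<le> \<delta>" for i
    proof -
      have "ennreal (diameter (E i) powr s) < ennreal (min e (\<delta> powr s))"
        using E(4) by (rule ennreal_suminf_lessD)
      then have "diameter (E i) powr s < \<delta> powr s" by (simp add: ennreal_less_iff)
      then show ?thesis
        using s(1) that powr_mono2[of s \<delta> "diameter (E i)"] by (meson less_imp_le not_less linorder_le_cases)
    qed
    moreover have "diam_power s (E i) = ennreal (diameter (E i) powr s)" for i
      using pos[of i] s(1) by (auto simp: diam_power_def)
    ultimately have "hausdorff_premeasure \<delta> s A \<le> (\<Sum>i. ennreal (diameter (E i) powr s))"
      unfolding hausdorff_premeasure_def using E(1,2) by (intro Inf_lower) (auto intro!: exI[of _ E])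
    also have "\<dots> \<le> ennreal e"
      using E(4) by (meson ennreal_leI less_imp_le min.cobounded1 order_trans)
    finally show ?thesis .
  qed
  then have "hausdorff_premeasure \<delta> s A = 0" if "0 < \<delta>" for \<delta>
    using that by (intro ennreal_zeroI) auto
  then have "hausdorff_measure s A = 0"
    unfolding hausdorff_measure_def by simp
  then have "hausdorff_dim A \<le> ereal s"
    unfolding hausdorff_dim_def using s(1) by (intro Inf_lower) auto
  then show "hausdorff_dim A \<le> a" using s(2) by simp
qed


section \<open>Borel measurability on the space of compact sets\<close>

lemma diameter_infdist_neighbourhood:
  fixes E :: "'a::metric_space set"
  assumes E: "bounded E" "E \<noteq> {}" and "0 < \<eta>"
  shows "bounded {x. infdist x E < \<eta>}" "diameter E \<le> diameter {x. infdist x E < \<eta>}"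
    "diameter {x. infdist x E < \<eta>} \<le> diameter E + 2 * \<eta>"
proof -
  let ?U = "{x. infdist x E < \<eta>}"
  have *: "dist x y \<le> diameter E + 2 * \<eta>" if x: "x \<in> ?U" and y: "y \<in> ?U" for x y
  proof -
    obtain x' where x': "x' \<in> E" "dist x x' < \<eta>"
      using x E(2) by (auto simp: infdist_notempty cInf_less_iff)
    obtain y' where y': "y' \<in> E" "dist y y' < \<eta>"
      using y E(2) by (auto simp: infdist_notempty cInf_less_iff)
    have "dist x' y' \<le> diameter E" using E(1) x'(1) y'(1) by (rule diameter_bounded_bound)
    moreover have "dist x y \<le> dist x x' + dist x' y' + dist y y'"
      using dist_triangle[of x y x'] dist_triangle[of x' y y'] by (simp add: dist_commute)
    ultimately show ?thesis using x'(2) y'(2) by linarith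
  qed
  have sub: "E \<subseteq> ?U" using \<open>0 < \<eta>\<close> by auto
  then obtain z where z: "z \<in> ?U" using E(2) by blast
  show bd: "bounded ?U"
    unfolding bounded_def using *[OF z] by blast
  show "diameter E \<le> diameter ?U" using sub bd by (rule diameter_subset)
  show "diameter ?U \<le> diameter E + 2 * \<eta>"
    unfolding diameter_def[of ?U] using z * by (auto intro!: cSUP_least)
qed

text \<open>
  A neighbourhood of \<open>E\<close> is open and its diameter exceeds that of \<open>E\<close> by as little as desired, but it
  need not be equal to it; this is where \<open>D\<close> has to contain an interval to the right of each of its points.
\<close>

lemma sorgenfrey_open_enlargement:
  fixes E :: "'a::metric_space set"
  assumes D: "D \<in> sorgenfrey_family" and E: "bounded E" "diameter E \<in> D" and "0 < e"
  obtains U where "open U" "E \<subseteq> U" "bounded U" "diameter U \<in> D"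
    "diameter U powr s < diameter E powr s + e"
proof -
  have pos: "0 < diameter E" using D E(2) by (rule sorgenfrey_family_pos)
  then have ne: "E \<noteq> {}" by auto
  obtain \<delta> where \<delta>: "0 < \<delta>" "{diameter E..<diameter E + \<delta>} \<subseteq> D"
    using D E(2) unfolding sorgenfrey_family_def by blast
  have "isCont (\<lambda>t. t powr s) (diameter E)"
    using pos by (intro continuous_intros) auto
  then obtain \<delta>' where \<delta>': "0 < \<delta>'"
      "\<And>t. \<bar>t - diameter E\<bar> < \<delta>' \<Longrightarrow> \<bar>t powr s - diameter E powr s\<bar> < e"
    using \<open>0 < e\<close> unfolding continuous_at_eps_delta dist_real_def by blast
  define \<eta> where "\<eta> = min \<delta> \<delta>' / 3"
  have \<eta>: "0 < \<eta>" "2 * \<eta> < \<delta>" "2 * \<eta> < \<delta>'" using \<delta>(1) \<delta>'(1) by (auto simp: \<eta>_def)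
  let ?U = "{x. infdist x E < \<eta>}"
  note U = diameter_infdist_neighbourhood[OF E(1) ne \<eta>(1)]
  show thesis
  proof
    show "open ?U" by (intro open_Collect_less continuous_intros)
    show "E \<subseteq> ?U" using \<eta>(1) by auto
    show "bounded ?U" by (rule U(1))
    show "diameter ?U \<in> D" using U \<eta> \<delta>(2) by (intro subsetD[OF \<delta>(2)]) auto
    show "diameter ?U powr s < diameter E powr s + e"
      using U(2,3) \<eta>(3) \<delta>'(2)[of "diameter ?U"] by (simp add: abs_less_iff)
  qed
qed

lemma ennreal_add_less_exists:
  fixes x c :: ennreal
  assumes "x < c"
  obtains e where "0 < e" "x + ennreal e < c"
proof -
  obtain y where y: "x < y" "y < c" using assms dense by blast
  then have "x < top" "y < top" using less_le_trans[OF _ top_greatest] by blast+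
  then obtain u v where uv: "x = ennreal u" "0 \<le> u" "y = ennreal v" "0 \<le> v"
    unfolding less_top_ennreal by blast
  then have "u < v" using y(1) by (simp add: ennreal_less_iff)
  then have "x + ennreal (v - u) = y"
    unfolding uv using uv(2) by (subst ennreal_plus[symmetric]) auto
  then show thesis
    using that[of "v - u"] y(2) \<open>u < v\<close> by simp
qed

lemma content_less_open_cover:
  fixes A :: "'a::metric_space set"
  assumes D: "D \<in> sorgenfrey_family" and "content_D D s A < c"
  obtains U where "open U" "A \<subseteq> U" "content_D D s U < c"
proof -
  obtain E where E: "A \<subseteq> (\<Union>i. E i)" "\<And>i. bounded (E i)" "\<And>i. diameter (E i) \<in> D"
    "(\<Sum>i. ennreal (diameter (E i) powr s)) < c"
    using content_less_cover[OF assms(2)] by blast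
  obtain e where e: "0 < e" "(\<Sum>i. ennreal (diameter (E i) powr s)) + ennreal e < c"
    using E(4) by (rule ennreal_add_less_exists)
  have "\<exists>U. open U \<and> E i \<subseteq> U \<and> bounded U \<and> diameter U \<in> D \<and>
      diameter U powr s < diameter (E i) powr s + e * (1 / 2) ^ Suc i" for i
  proof -
    have "0 < e * (1 / 2) ^ Suc i" using e(1) by simp
    then show ?thesis
      by (rule sorgenfrey_open_enlargement[where s = s, OF D E(2)[of i] E(3)[of i]]) blast
  qed
  then obtain U where U: "\<And>i. open (U i)" "\<And>i. E i \<subseteq> U i" "\<And>i. bounded (U i)" "\<And>i. diameter (U i) \<in> D"
      "\<And>i. diameter (U i) powr s < diameter (E i) powr s + e * (1 / 2) ^ Suc i"
    by metis
  show thesis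
  proof
    show "open (\<Union>i. U i)" using U(1) by blast
    show "A \<subseteq> (\<Union>i. U i)" using E(1) U(2) by blast
    have "content_D D s (\<Union>i. U i) \<le> (\<Sum>i. ennreal (diameter (U i) powr s))"
      using U by (intro content_le_cover) auto
    also have "\<dots> \<le> (\<Sum>i. ennreal (diameter (E i) powr s) + ennreal (e * (1 / 2) ^ Suc i))"
      using U(5) e(1) by (intro suminf_le) (auto simp flip: ennreal_plus intro!: ennreal_leI less_imp_le)
    also have "\<dots> = (\<Sum>i. ennreal (diameter (E i) powr s)) + (\<Sum>i. ennreal (e * (1 / 2) ^ Suc i))"
      by (intro suminf_add[symmetric]) auto
    also have "(\<Sum>i. ennreal (e * (1 / 2) ^ Suc i)) = ennreal e"
      using e(1) by (intro suminf_ennreal_geometric) simp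
    also note e(2)
    finally show "content_D D s (\<Union>i. U i) < c" .
  qed
qed

lemma open_compacts_subset:
  fixes U :: "'a::metric_space set"
  assumes "open U"
  shows "open {K. set_of_compacts K \<subseteq> U}"
  unfolding open_dist
proof clarsimp
  fix K :: "'a compacts" assume "set_of_compacts K \<subseteq> U"
  then obtain \<epsilon> where \<epsilon>: "0 < \<epsilon>" "(\<Union>x\<in>set_of_compacts K. ball x \<epsilon>) \<subseteq> U"
    using compact_subset_open_imp_ball_epsilon_subset[OF compact_set_of_compacts assms] by blast
  have "set_of_compacts L \<subseteq> U" if "dist L K < \<epsilon>" for L
  proof
    fix y assume "y \<in> set_of_compacts L"
    then have "infdist y (set_of_compacts K) < \<epsilon>"
      using infdist_le_hausdorff_excess[OF compact_set_of_compacts, of y L "set_of_compacts K"] that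
      by (simp add: dist_compacts_def)
    then obtain x where "x \<in> set_of_compacts K" "dist x y < \<epsilon>"
      unfolding dist_commute[of _ y]
      by (auto simp: infdist_notempty[OF set_of_compacts_nonempty] cInf_less_iff set_of_compacts_nonempty)
    then show "y \<in> U" using \<epsilon>(2) by (intro subsetD[OF \<epsilon>(2)]) auto
  qed
  then show "\<exists>e>0. \<forall>y. dist y K < e \<longrightarrow> set_of_compacts y \<subseteq> U"
    using \<epsilon>(1) by blast
qed

lemma open_compacts_content_less:
  fixes D :: "real set"
  assumes D: "D \<in> sorgenfrey_family"
  shows "open {K :: 'a::metric_space compacts. content_D D s (set_of_compacts K) < c}"
proof (subst open_subopen, clarify)
  fix K :: "'a compacts" assume "content_D D s (set_of_compacts K) < c"
  then obtain U where U: "open U" "set_of_compacts K \<subseteq> U" "content_D D s U < c"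
    by (rule content_less_open_cover[OF D])
  then have "{K. set_of_compacts K \<subseteq> U} \<subseteq> {K. content_D D s (set_of_compacts K) < c}"
    by (intro Collect_mono impI) (rule le_less_trans[OF content_mono])
  then show "\<exists>T. open T \<and> K \<in> T \<and> T \<subseteq> {K. content_D D s (set_of_compacts K) < c}"
    using U(2) open_compacts_subset[OF U(1)] by blast
qed

text \<open>
  The content is monotone in the exponent where it vanishes, so \<open>dim_D D K < a\<close> means that it vanishes
  for some rational \<open>q < a\<close>; and its zero set is a countable intersection of open sets.
\<close>

lemma dim_D_compacts_borel_measurable:
  fixes D :: "real set"
  assumes D: "D \<in> sorgenfrey_family"
  shows "(\<lambda>K :: 'a::metric_space compacts. dim_D D (set_of_compacts K)) \<in> borel_measurable borel"
proof (rule borel_measurableI_less)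
  fix a :: ereal
  have null: "{K :: 'a compacts. content_D D s (set_of_compacts K) = 0} \<in> sets borel" for s
  proof -
    have "{K :: 'a compacts. content_D D s (set_of_compacts K) = 0}
        = (\<Inter>k::nat. {K. content_D D s (set_of_compacts K) < ennreal (1 / Suc k)})"
    proof (intro equalityI subsetI; clarsimp)
      fix K :: "'a compacts"
      assume *: "\<forall>k. content_D D s (set_of_compacts K) < ennreal (1 / (1 + real k))"
      show "content_D D s (set_of_compacts K) = 0"
      proof (rule ennreal_zeroI)
        fix e :: real assume "0 < e"
        then obtain k where "1 / (1 + real k) < e"
          using nat_approx_posE[of e] by (metis of_nat_Suc)
        then show "content_D D s (set_of_compacts K) \<le> ennreal e"
          using * ennreal_leI[of _ e] by (meson less_imp_le order_trans)
      qed
    qed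
    also have "\<dots> \<in> sets borel"
      by (intro sets.countable_INT'' borel_open open_compacts_content_less[OF D]) auto
    finally show ?thesis .
  qed
  have "{K :: 'a compacts. dim_D D (set_of_compacts K) < a}
      = (\<Union>q\<in>{q::rat. 0 < q \<and> ereal (of_rat q) < a}. {K. content_D D (of_rat q) (set_of_compacts K) = 0})"
  proof (intro equalityI subsetI; clarsimp)
    fix K :: "'a compacts" assume "dim_D D (set_of_compacts K) < a"
    then obtain s where s: "0 < s" "ereal s < a" "content_D D s (set_of_compacts K) = 0"
      unfolding dim_D_less_iff[OF D] by blast
    obtain b where b: "ereal s < ereal b" "ereal b < a" using s(2) ereal_dense2 by blast
    then obtain q :: rat where q: "s < of_rat q" "of_rat q < b" using of_rat_dense by auto
    then have "0 < q" using s(1) by (metis less_trans of_rat_0 of_rat_less)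
    moreover have "ereal (of_rat q) < a" using q(2) b(2) by (meson ereal_less(2) less_ereal.simps(1) less_trans)
    ultimately show "\<exists>q. 0 < q \<and> ereal (of_rat q) < a \<and> content_D D (of_rat q) (set_of_compacts K) = 0"
      using content_zero_mono[OF D s(1) less_imp_le[OF q(1)] s(3)] by blast
  next
    fix K :: "'a compacts" and q :: rat
    assume "0 < q" "ereal (of_rat q) < a" "content_D D (of_rat q) (set_of_compacts K) = 0"
    then show "dim_D D (set_of_compacts K) < a"
      unfolding dim_D_less_iff[OF D] by (intro exI[of _ "of_rat q"]) simp
  qed
  then show "{K \<in> space (borel :: 'a compacts measure). dim_D D (set_of_compacts K) < a} \<in> sets borel"
    using null by (auto intro!: sets.countable_UN'')
qed

section \<open>A mass distribution principle on trees\<close>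

definition addresses :: "(nat \<Rightarrow> nat) \<Rightarrow> (nat \<Rightarrow> nat) set" where
  "addresses M = {\<sigma>. \<forall>k. \<sigma> k < M k}"

definition admissible_word :: "(nat \<Rightarrow> nat) \<Rightarrow> nat list \<Rightarrow> bool" where
  "admissible_word M w \<longleftrightarrow> (\<forall>k<length w. w ! k < M k)"

lemma admissible_word_snoc:
  "admissible_word M w \<Longrightarrow> i < M (length w) \<Longrightarrow> admissible_word M (w @ [i])"
  by (auto simp: admissible_word_def nth_append less_Suc_eq)

text \<open>
  Points are coded by infinite sequences \<open>\<sigma>\<close> through a map \<open>p\<close>; nodes of the tree are finite words.
\<close>

definition cylinder :: "((nat \<Rightarrow> nat) \<Rightarrow> 'a) \<Rightarrow> (nat \<Rightarrow> nat) \<Rightarrow> nat list \<Rightarrow> 'a set" where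
  "cylinder p M w = p ` {\<tau> \<in> addresses M. map \<tau> [0..<length w] = w}"

lemma cylinder_snoc_subset: "cylinder p M (w @ [i]) \<subseteq> cylinder p M w"
  by (auto simp: cylinder_def)

lemma mem_cylinder_prefix: "\<sigma> \<in> addresses M \<Longrightarrow> p \<sigma> \<in> cylinder p M (map \<sigma> [0..<k])"
  by (auto simp: cylinder_def)

lemma cylinder_sibling_dist:
  assumes sep: "\<And>\<sigma> \<tau> k. \<sigma> \<in> addresses M \<Longrightarrow> \<tau> \<in> addresses M \<Longrightarrow> \<forall>j<k. \<sigma> j = \<tau> j \<Longrightarrow> \<sigma> k \<noteq> \<tau> k \<Longrightarrow>
      \<gamma> (map \<sigma> [0..<k]) \<le> dist (p \<sigma>) (p \<tau>)"
    and x: "x \<in> cylinder p M (w @ [a])" and y: "y \<in> cylinder p M (w @ [b])" and "a \<noteq> b"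
  shows "\<gamma> w \<le> dist x y"
proof -
  obtain \<sigma> where \<sigma>: "\<sigma> \<in> addresses M" "map \<sigma> [0..<length w] = w" "\<sigma> (length w) = a" "x = p \<sigma>"
    using x by (auto simp: cylinder_def)
  obtain \<tau> where \<tau>: "\<tau> \<in> addresses M" "map \<tau> [0..<length w] = w" "\<tau> (length w) = b" "y = p \<tau>"
    using y by (auto simp: cylinder_def)
  have "\<forall>j<length w. \<sigma> j = \<tau> j"
    using \<sigma>(2) \<tau>(2) by (metis add.left_neutral length_upt diff_zero nth_map nth_upt)
  then show ?thesis
    using sep[OF \<sigma>(1) \<tau>(1)] \<sigma> \<tau> \<open>a \<noteq> b\<close> by metis
qed

lemma ennreal_sum_at_most_one_le:
  fixes c :: ennreal
  assumes "finite I" "\<And>a b. a \<in> I \<Longrightarrow> b \<in> I \<Longrightarrow> P a \<Longrightarrow> P b \<Longrightarrow> a = b"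
  shows "(\<Sum>i\<in>I. if P i then c else 0) \<le> c"
proof (cases "\<exists>a\<in>I. P a")
  case True
  then obtain a where "a \<in> I" "P a" by blast
  then have "(\<Sum>i\<in>I. if P i then c else 0) = (\<Sum>i\<in>I. if i = a then c else 0)"
    using assms(2) by (intro sum.cong) auto
  then show ?thesis using assms(1) \<open>a \<in> I\<close> by simp
next
  case False
  then show ?thesis by (simp add: sum.neutral)
qed

text \<open>
  A mass distribution principle that uses no measure and no compactness. The mass \<open>\<mu>\<close> of a node is
  at most the total mass of its children, and points below different children of \<open>w\<close> are at
  distance at least \<open>\<gamma> w\<close>. Suppose that a cover had cost less than \<open>\<mu> []\<close>. If the sets that meet the
  cylinder of \<open>w\<close> cost less than \<open>\<mu> w\<close>, then none of them has diameter \<open>\<ge> \<gamma> w\<close>, as such a set alone would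
  cost \<open>\<mu> w\<close>; so each of them meets at most one child, and for some child the cost is again less
  than the mass. Descending forever, a point is reached all of whose cylinders are met only by sets
  smaller than the gap. Since the gaps tend to \<open>0\<close>, the set of the cover that contains this point would
  have diameter \<open>0\<close>, whereas diameters in \<open>D\<close> are positive.
\<close>

lemma content_ge_tree_mass:
  fixes p :: "(nat \<Rightarrow> nat) \<Rightarrow> 'a::metric_space" and \<mu> \<gamma> :: "nat list \<Rightarrow> real"
  assumes pos: "\<And>d. d \<in> D \<Longrightarrow> 0 < d"
    and sep: "\<And>\<sigma> \<tau> k. \<sigma> \<in> addresses M \<Longrightarrow> \<tau> \<in> addresses M \<Longrightarrow> \<forall>j<k. \<sigma> j = \<tau> j \<Longrightarrow> \<sigma> k \<noteq> \<tau> k \<Longrightarrow>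
      \<gamma> (map \<sigma> [0..<k]) \<le> dist (p \<sigma>) (p \<tau>)"
    and shrink: "\<And>\<sigma>. \<sigma> \<in> addresses M \<Longrightarrow> (\<lambda>k. \<gamma> (map \<sigma> [0..<k])) \<longlonglongrightarrow> 0"
    and nonneg: "\<And>w. 0 \<le> \<mu> w"
    and mass: "\<And>w. admissible_word M w \<Longrightarrow> \<mu> w \<le> (\<Sum>i<M (length w). \<mu> (w @ [i]))"
    and cost: "\<And>w d. admissible_word M w \<Longrightarrow> d \<in> D \<Longrightarrow> \<gamma> w \<le> d \<Longrightarrow> \<mu> w \<le> d powr s"
  shows "ennreal (\<mu> []) \<le> content_D D s (p ` addresses M)"
proof (rule ccontr)
  assume "\<not> ennreal (\<mu> []) \<le> content_D D s (p ` addresses M)"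
  then have "content_D D s (p ` addresses M) < ennreal (\<mu> [])" by simp
  then obtain U where U: "p ` addresses M \<subseteq> (\<Union>j. U j)" "\<And>j. bounded (U j)" "\<And>j. diameter (U j) \<in> D"
    "(\<Sum>j. ennreal (diameter (U j) powr s)) < ennreal (\<mu> [])"
    by (rule content_less_cover) blast
  define \<phi> where "\<phi> j = ennreal (diameter (U j) powr s)" for j
  define meets where "meets j w \<longleftrightarrow> U j \<inter> cylinder p M w \<noteq> {}" for j w
  define total where "total w = (\<Sum>j. if meets j w then \<phi> j else 0)" for w
  have small: "\<phi> j < ennreal (\<mu> w)" if "total w < ennreal (\<mu> w)" "meets j w" for j w
    using ennreal_suminf_lessD[OF that(1)[unfolded total_def], of j] that(2) by simp
  have short: "diameter (U j) < \<gamma> w"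
    if "admissible_word M w" "total w < ennreal (\<mu> w)" "meets j w" for j w
  proof (rule ccontr)
    assume "\<not> diameter (U j) < \<gamma> w"
    then have "\<mu> w \<le> diameter (U j) powr s" using cost[OF that(1) U(3)] by simp
    then show False
      using small[OF that(2,3)] unfolding \<phi>_def by (meson ennreal_leI leD)
  qed
  have descend: "\<exists>i<M (length w). total (w @ [i]) < ennreal (\<mu> (w @ [i]))"
    if w: "admissible_word M w" "total w < ennreal (\<mu> w)" for w
  proof (rule ccontr)
    assume "\<not> (\<exists>i<M (length w). total (w @ [i]) < ennreal (\<mu> (w @ [i])))"
    then have ge: "ennreal (\<mu> (w @ [i])) \<le> total (w @ [i])" if "i < M (length w)" for i
      using that not_less by blast
    have one: "(\<Sum>i<M (length w). if meets j (w @ [i]) then \<phi> j else 0) \<le> (if meets j w then \<phi> j else 0)"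
      for j
    proof (cases "meets j w")
      case True
      have "a = b" if ab: "meets j (w @ [a])" "meets j (w @ [b])" for a b
      proof (rule ccontr)
        assume "a \<noteq> b"
        obtain x where x: "x \<in> U j" "x \<in> cylinder p M (w @ [a])"
          using ab(1) unfolding meets_def by blast
        obtain y where y: "y \<in> U j" "y \<in> cylinder p M (w @ [b])"
          using ab(2) unfolding meets_def by blast
        have "\<gamma> w \<le> dist x y" using sep x(2) y(2) \<open>a \<noteq> b\<close> by (rule cylinder_sibling_dist)
        also have "\<dots> \<le> diameter (U j)" using U(2) x(1) y(1) by (rule diameter_bounded_bound)
        finally show False using short[OF w True] by simp
      qed
      then show ?thesis using True by (simp add: ennreal_sum_at_most_one_le)
    next
      case False
      then have "\<not> meets j (w @ [i])" for i
        using cylinder_snoc_subset[of p M w i] unfolding meets_def by blast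
      then show ?thesis by simp
    qed
    have "ennreal (\<mu> w) \<le> ennreal (\<Sum>i<M (length w). \<mu> (w @ [i]))"
      using mass[OF w(1)] by (rule ennreal_leI)
    also have "\<dots> = (\<Sum>i<M (length w). ennreal (\<mu> (w @ [i])))"
      using nonneg by simp
    also have "\<dots> \<le> (\<Sum>i<M (length w). total (w @ [i]))"
      using ge by (intro sum_mono) auto
    also have "\<dots> = (\<Sum>j. \<Sum>i<M (length w). if meets j (w @ [i]) then \<phi> j else 0)"
      unfolding total_def by (intro suminf_sum[symmetric] summableI)
    also have "\<dots> \<le> total w"
      unfolding total_def by (intro suminf_le summableI one)
    finally show False using w(2) by simp
  qed
  have "total [] \<le> (\<Sum>j. \<phi> j)"
    unfolding total_def by (intro suminf_le summableI) simp
  then have root: "total [] < ennreal (\<mu> [])"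
    using U(4) unfolding \<phi>_def by (rule le_less_trans)
  let ?P = "\<lambda>k w. length w = k \<and> admissible_word M w \<and> total w < ennreal (\<mu> w)"
  obtain W where W: "\<And>k. ?P k (W k)" "\<And>k. \<exists>i. W (Suc k) = W k @ [i]"
  proof -
    have "\<exists>W. \<forall>k. ?P k (W k) \<and> (\<exists>i. W (Suc k) = W k @ [i])"
    proof (rule dependent_nat_choice)
      show "\<exists>w. ?P 0 w" using root by (simp add: admissible_word_def)
      fix w k assume w: "?P k w"
      then obtain i where "i < M (length w)" "total (w @ [i]) < ennreal (\<mu> (w @ [i]))"
        using descend by blast
      then have "?P (Suc k) (w @ [i])" using w admissible_word_snoc by simp
      then show "\<exists>y. ?P (Suc k) y \<and> (\<exists>i. y = w @ [i])" by blast
    qed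
    then show thesis using that by blast
  qed
  define \<sigma> where "\<sigma> k = W (Suc k) ! k" for k
  have prefix: "map \<sigma> [0..<k] = W k" for k
  proof (induction k)
    case 0
    then show ?case using W(1)[of 0] by simp
  next
    case (Suc k)
    obtain i where i: "W (Suc k) = W k @ [i]" using W(2) by blast
    then have "\<sigma> k = i" using W(1)[of k] by (simp add: \<sigma>_def nth_append)
    then show ?case using Suc i by simp
  qed
  have \<sigma>: "\<sigma> \<in> addresses M"
    unfolding addresses_def using W(1) by (auto simp: \<sigma>_def admissible_word_def)
  then obtain j where j: "p \<sigma> \<in> U j" using U(1) by blast
  have meets: "meets j (W k)" for k
    using mem_cylinder_prefix[OF \<sigma>, of p k] j unfolding meets_def prefix by blast
  have "diameter (U j) < \<gamma> (map \<sigma> [0..<k])" for k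
    unfolding prefix using W(1) meets by (intro short) auto
  then have "diameter (U j) \<le> 0"
    using shrink[OF \<sigma>] by (intro LIMSEQ_le_const[of "\<lambda>k. \<gamma> (map \<sigma> [0..<k])"]) (auto intro: less_imp_le)
  then show False using pos[OF U(3)[of j]] by simp
qed


section \<open>Self-similar sets\<close>

lemma similarity_dim_equation:
  assumes "0 < m" and r: "\<And>i. i < m \<Longrightarrow> 0 < r i \<and> r i < 1"
  shows "(\<Sum>i<m. r i powr similarity_dim m r) = 1" "0 \<le> similarity_dim m r"
proof -
  let ?g = "\<lambda>s. \<Sum>i<m. r i powr s"
  have dec: "?g t < ?g s" if "s < t" for s t
    using \<open>0 < m\<close> r that by (intro sum_strict_mono) (auto intro!: powr_less_mono' simp: lessThan_empty_iff)
  obtain q where q: "0 < q" "q < 1" "\<And>i. i < m \<Longrightarrow> r i \<le> q"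
  proof
    have "finite (r ` {..<m})" "r ` {..<m} \<noteq> {}" using \<open>0 < m\<close> by auto
    note Max_in[OF this]
    then show "0 < Max (r ` {..<m})" "Max (r ` {..<m}) < 1" using r by auto
    show "r i \<le> Max (r ` {..<m})" if "i < m" for i using that by (intro Max_ge) auto
  qed
  obtain k where "q ^ k < 1 / real m"
    using real_arch_pow_inv[of "1 / real m" q] q \<open>0 < m\<close> by auto
  define b where "b = real k"
  have b: "0 \<le> b" "real m * q powr b < 1"
    using \<open>q ^ k < 1 / real m\<close> q(1) \<open>0 < m\<close> by (auto simp: b_def powr_realpow field_simps)
  have "?g b \<le> (\<Sum>i<m. q powr b)"
    using q r b by (intro sum_mono powr_mono2) (auto simp: less_imp_le)
  then have "?g b \<le> 1" using b by simp
  moreover have "1 \<le> ?g 0"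
  proof -
    have "?g 0 = (\<Sum>i<m. 1)" using r by (intro sum.cong) force+
    then show ?thesis using \<open>0 < m\<close> by simp
  qed
  moreover have "continuous_on {0..b} ?g"
    using r by (intro continuous_intros) force
  ultimately obtain s where s: "0 \<le> s" "?g s = 1"
    using IVT2'[of ?g b 1 0] b by auto
  have "similarity_dim m r = s"
    unfolding similarity_dim_def
  proof (rule the_equality)
    show "?g s = 1" by (rule s(2))
    fix t assume "?g t = 1"
    then show "t = s" using dec[of s t] dec[of t s] s(2) by (cases s t rule: linorder_cases) auto
  qed
  then show "?g (similarity_dim m r) = 1" "0 \<le> similarity_dim m r"
    using s by auto
qed

fun word_map :: "(nat \<Rightarrow> 'a \<Rightarrow> 'a) \<Rightarrow> nat list \<Rightarrow> 'a \<Rightarrow> 'a" where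
  "word_map f [] = id"
| "word_map f (i # w) = f i \<circ> word_map f w"

lemma word_map_snoc: "word_map f (w @ [i]) = word_map f w \<circ> f i"
  by (induction w) (auto simp: o_assoc)

lemma word_map_dist:
  assumes "\<And>i. i \<in> set w \<Longrightarrow> contracting_similarity (r i) (f i)"
  shows "dist (word_map f w x) (word_map f w y) = prod_list (map r w) * dist x y"
  using assms by (induction w) (auto simp: contracting_similarity_def)

lemma strong_separation_gap:
  fixes S :: "'a::heine_borel set"
  assumes S: "self_similar m f r S" "strong_separation m f S"
  obtains \<delta> where "0 < \<delta>"
    "\<And>a b x y. a < m \<Longrightarrow> b < m \<Longrightarrow> a \<noteq> b \<Longrightarrow> x \<in> f a ` S \<Longrightarrow> y \<in> f b ` S \<Longrightarrow> \<delta> \<le> dist x y"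
proof -
  have comp: "compact (f a ` S)" if "a < m" for a
  proof (rule compact_continuous_image)
    have "(r a)-lipschitz_on S (f a)"
      using S(1) that by (intro lipschitz_onI) (auto simp: self_similar_def contracting_similarity_def)
    then show "continuous_on S (f a)" by (rule lipschitz_on_continuous_on)
    show "compact S" using S(1) by (simp add: self_similar_def)
  qed
  have "\<exists>d>0. \<forall>x\<in>f a ` S. \<forall>y\<in>f b ` S. d \<le> dist x y" if "a < m" "b < m" "a \<noteq> b" for a b
    using separate_compact_closed[OF comp compact_imp_closed[OF comp], of a b] S(2) that
    by (auto simp: strong_separation_def)
  then obtain d where d: "\<And>a b. a < m \<Longrightarrow> b < m \<Longrightarrow> a \<noteq> b \<Longrightarrow>
      0 < d a b \<and> (\<forall>x\<in>f a ` S. \<forall>y\<in>f b ` S. d a b \<le> dist x y)"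
    by metis
  \<comment> \<open>The element \<open>1\<close> makes the minimum meaningful when there is a single similarity.\<close>
  let ?I = "{(a, b). a < m \<and> b < m \<and> a \<noteq> b}"
  let ?d = "insert 1 ((\<lambda>(a, b). d a b) ` ?I)"
  have "finite ?I" by (rule finite_subset[of _ "{..<m} \<times> {..<m}"]) auto
  then have fin: "finite ?d" by simp
  show thesis
  proof
    show "0 < Min ?d" using fin d by (subst Min_gr_iff) auto
    fix a b x y assume ab: "a < m" "b < m" "a \<noteq> b" and xy: "x \<in> f a ` S" "y \<in> f b ` S"
    have "Min ?d \<le> d a b" using fin ab by (intro Min_le) auto
    also have "\<dots> \<le> dist x y" using d ab xy by blast
    finally show "Min ?d \<le> dist x y" .
  qed
qed

lemma self_similar_ratio_bounds:
  assumes "self_similar m f r S"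
  obtains q Q where "0 < q" "0 < Q" "Q < 1" "\<And>i. i < m \<Longrightarrow> q \<le> r i \<and> r i \<le> Q" "0 < m"
proof -
  have r: "0 < r i \<and> r i < 1" if "i < m" for i
    using assms that by (auto simp: self_similar_def contracting_similarity_def)
  have "0 < m" using assms by (cases m) (auto simp: self_similar_def)
  then have fin: "finite (r ` {..<m})" "r ` {..<m} \<noteq> {}" by auto
  show thesis
  proof (rule that[of "Min (r ` {..<m})" "Max (r ` {..<m})"])
    show "0 < Max (r ` {..<m})" "Max (r ` {..<m}) < 1" using Max_in[OF fin] r by auto
    show "0 < Min (r ` {..<m})" using Min_in[OF fin] r by auto
    show "Min (r ` {..<m}) \<le> r i \<and> r i \<le> Max (r ` {..<m})" if "i < m" for i
      using that fin by auto
  qed (use \<open>0 < m\<close> in auto)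
qed

text \<open>
  The nodes are the words \<open>w\<close> over the indices of the similarities. With \<open>R w\<close> the ratio of the composed
  similarity and \<open>\<delta>\<close> a lower bound for the distance of two first-level pieces, the gap at \<open>w\<close> is \<open>R w * \<delta>\<close>, and the
  mass \<open>(R w * \<delta>) powr s\<close> is additive by the equation for \<open>s\<close>. With this normalisation the comparison of
  cost and mass is monotonicity of the power.
\<close>

lemma dim_D_self_similar_ge:
  fixes S :: "'a::heine_borel set"
  assumes D: "D \<in> sorgenfrey_family"
    and S: "self_similar m f r S" "strong_separation m f S"
    and s: "(\<Sum>i<m. r i powr s) = 1" "0 < s"
  shows "ereal s \<le> dim_D D S"
proof (rule dim_D_ge[OF D])
  obtain \<delta> where \<delta>: "0 < \<delta>"
    "\<And>a b x y. a < m \<Longrightarrow> b < m \<Longrightarrow> a \<noteq> b \<Longrightarrow> x \<in> f a ` S \<Longrightarrow> y \<in> f b ` S \<Longrightarrow> \<delta> \<le> dist x y"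
    using strong_separation_gap[OF S] by blast
  obtain Q where Q: "0 < Q" "Q < 1" "\<And>i. i < m \<Longrightarrow> r i \<le> Q"
    using self_similar_ratio_bounds[OF S(1)] by metis
  have sim: "contracting_similarity (r i) (f i)" if "i < m" for i
    using S(1) that by (simp add: self_similar_def)
  then have r: "0 < r i" if "i < m" for i
    using that by (auto simp: contracting_similarity_def)
  have compS: "compact S" "S \<noteq> {}" and S_eq: "S = (\<Union>i<m. f i ` S)"
    using S(1) by (auto simp: self_similar_def)
  define M where "M = (\<lambda>k::nat. m)"
  define R where "R w = prod_list (map r w)" for w
  have letters: "set w \<subseteq> {..<m}" if "admissible_word M w" for w
    using that by (auto simp: admissible_word_def M_def in_set_conv_nth)
  have R_nonneg: "0 < R w" if "set w \<subseteq> {..<m}" for w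
    using that r unfolding R_def by (induction w) auto
  have R_le: "R w \<le> Q ^ length w" if "set w \<subseteq> {..<m}" for w
    using that
  proof (induction w)
    case (Cons i w)
    then show ?case
      using Q r[of i] R_nonneg[of w] unfolding R_def by (auto intro!: mult_mono simp: less_imp_le)
  qed (simp add: R_def)
  have dist_word: "dist (word_map f w x) (word_map f w y) = R w * dist x y" if "set w \<subseteq> {..<m}" for w x y
    unfolding R_def using that sim by (intro word_map_dist) auto
  have prefix_letters: "set (map \<sigma> [0..<k]) \<subseteq> {..<m}" if "\<sigma> \<in> addresses M" for \<sigma> k
    using that by (auto simp: addresses_def M_def)
  have ex: "\<exists>x. \<forall>k. x \<in> word_map f (map \<sigma> [0..<k]) ` S" if \<sigma>: "\<sigma> \<in> addresses M" for \<sigma>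
  proof -
    let ?X = "\<lambda>k. word_map f (map \<sigma> [0..<k]) ` S"
    have "\<Inter>(range ?X) \<noteq> {}"
    proof (rule compact_nest)
      show "compact (?X k)" for k
      proof (rule compact_continuous_image[OF _ compS(1)])
        have "(R (map \<sigma> [0..<k]))-lipschitz_on S (word_map f (map \<sigma> [0..<k]))"
          using dist_word[OF prefix_letters[OF \<sigma>]] R_nonneg[OF prefix_letters[OF \<sigma>]]
          by (intro lipschitz_onI) (auto simp: less_imp_le)
        then show "continuous_on S (word_map f (map \<sigma> [0..<k]))" by (rule lipschitz_on_continuous_on)
      qed
      show "?X k \<noteq> {}" for k using compS(2) by simp
      have "?X (Suc k) \<subseteq> ?X k" for k
      proof -
        have "f (\<sigma> k) ` S \<subseteq> S" using \<sigma> S_eq by (auto simp: addresses_def M_def)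
        then show ?thesis by (auto simp: word_map_snoc)
      qed
      then show "?X k' \<subseteq> ?X k" if "k \<le> k'" for k k'
        using that by (rule lift_Suc_antimono_le)
    qed
    then show ?thesis by blast
  qed
  define p where "p \<sigma> = (SOME x. \<forall>k. x \<in> word_map f (map \<sigma> [0..<k]) ` S)" for \<sigma>
  have p: "p \<sigma> \<in> word_map f (map \<sigma> [0..<k]) ` S" if "\<sigma> \<in> addresses M" for \<sigma> k
    unfolding p_def using someI_ex[OF ex[OF that]] by blast
  have "ennreal ((R [] * \<delta>) powr s) \<le> content_D D s (p ` addresses M)"
  proof (rule content_ge_tree_mass[where \<gamma> = "\<lambda>w. R w * \<delta>" and \<mu> = "\<lambda>w. (R w * \<delta>) powr s"])
    show "0 < d" if "d \<in> D" for d using D that by (rule sorgenfrey_family_pos)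
    show "R (map \<sigma> [0..<k]) * \<delta> \<le> dist (p \<sigma>) (p \<tau>)"
      if "\<sigma> \<in> addresses M" "\<tau> \<in> addresses M" "\<forall>j<k. \<sigma> j = \<tau> j" "\<sigma> k \<noteq> \<tau> k" for \<sigma> \<tau> k
    proof -
      have eq: "map \<tau> [0..<k] = map \<sigma> [0..<k]" using that(3) by simp
      have "p \<sigma> \<in> word_map f (map \<sigma> [0..<k]) ` f (\<sigma> k) ` S"
        "p \<tau> \<in> word_map f (map \<sigma> [0..<k]) ` f (\<tau> k) ` S"
        using p[OF that(1), of "Suc k"] p[OF that(2), of "Suc k"]
        by (simp_all add: word_map_snoc image_comp eq)
      then obtain x y where x: "x \<in> f (\<sigma> k) ` S" "p \<sigma> = word_map f (map \<sigma> [0..<k]) x"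
        and y: "y \<in> f (\<tau> k) ` S" "p \<tau> = word_map f (map \<sigma> [0..<k]) y"
        by blast
      have "\<delta> \<le> dist x y"
        using that x(1) y(1) by (intro \<delta>(2)) (auto simp: addresses_def M_def)
      then show ?thesis
        unfolding x(2) y(2) dist_word[OF prefix_letters[OF that(1)]]
        using R_nonneg[OF prefix_letters[OF that(1)]] by (intro mult_left_mono) (auto simp: less_imp_le)
    qed
    show "(\<lambda>k. R (map \<sigma> [0..<k]) * \<delta>) \<longlonglongrightarrow> 0" if "\<sigma> \<in> addresses M" for \<sigma>
    proof (rule tendsto_sandwich[OF _ _ tendsto_const])
      show "\<forall>\<^sub>F k in sequentially. 0 \<le> R (map \<sigma> [0..<k]) * \<delta>"
        using R_nonneg[OF prefix_letters[OF that]] \<delta>(1) by (intro always_eventually) (simp add: less_imp_le)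
      show "\<forall>\<^sub>F k in sequentially. R (map \<sigma> [0..<k]) * \<delta> \<le> Q ^ k * \<delta>"
        using R_le[OF prefix_letters[OF that]] \<delta>(1) by (intro always_eventually allI mult_right_mono) auto
      show "(\<lambda>k. Q ^ k * \<delta>) \<longlonglongrightarrow> 0"
        using Q by (intro tendsto_mult_left_zero LIMSEQ_power_zero) auto
    qed
    show "(R w * \<delta>) powr s \<le> (\<Sum>i<M (length w). (R (w @ [i]) * \<delta>) powr s)"
      if "admissible_word M w" for w
    proof -
      have "(\<Sum>i<M (length w). (R (w @ [i]) * \<delta>) powr s) = (\<Sum>i<m. (R w * \<delta>) powr s * r i powr s)"
        unfolding M_def
      proof (rule sum.cong[OF refl])
        fix i assume i: "i \<in> {..<m}"
        have "R (w @ [i]) * \<delta> = (R w * \<delta>) * r i" by (simp add: R_def)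
        then show "(R (w @ [i]) * \<delta>) powr s = (R w * \<delta>) powr s * r i powr s"
          by (simp only: powr_mult)
      qed
      then show ?thesis using s(1) by (simp flip: sum_distrib_left)
    qed
    show "(R w * \<delta>) powr s \<le> d powr s" if "admissible_word M w" "R w * \<delta> \<le> d" for w d
      using that R_nonneg[OF letters[OF that(1)]] \<delta>(1) s(2) by (intro powr_mono2) (auto simp: less_imp_le)
  qed auto
  also have "\<dots> \<le> content_D D s S"
    using p[of _ 0] by (intro content_mono) auto
  finally have "ennreal (\<delta> powr s) \<le> content_D D s S" by (simp add: R_def)
  then show "content_D D s S \<noteq> 0" using \<delta>(1) by auto
qed

lemma ball_coverable_similarity_image:
  assumes f: "\<And>x y. dist (f x) (f y) = r * dist x y" and "0 < r"
    and A: "ball_coverable A (\<rho> / r) N"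
  shows "ball_coverable (f ` A) \<rho> N"
proof -
  obtain T where T: "finite T" "real (card T) \<le> N" "A \<subseteq> (\<Union>t\<in>T. cball t (\<rho> / r))"
    using A by (auto simp: ball_coverable_def)
  have "f ` A \<subseteq> (\<Union>t\<in>f ` T. cball t \<rho>)"
    using T(3) \<open>0 < r\<close> by (fastforce simp: f pos_le_divide_eq mult.commute)
  moreover have "real (card (f ` T)) \<le> N"
    using card_image_le[OF T(1), of f] T(2) by linarith
  ultimately show ?thesis
    unfolding ball_coverable_def using T(1) by blast
qed

lemma ball_coverable_UN:
  assumes "finite I" "\<And>i. i \<in> I \<Longrightarrow> ball_coverable (A i) \<rho> (N i)"
  shows "ball_coverable (\<Union>i\<in>I. A i) \<rho> (\<Sum>i\<in>I. N i)"
proof -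
  obtain T where T: "\<And>i. i \<in> I \<Longrightarrow> finite (T i) \<and> real (card (T i)) \<le> N i \<and> A i \<subseteq> (\<Union>t\<in>T i. cball t \<rho>)"
    using assms(2) unfolding ball_coverable_def by metis
  have "real (card (\<Union>i\<in>I. T i)) \<le> (\<Sum>i\<in>I. real (card (T i)))"
    using card_UN_le[OF assms(1), of T] by (simp flip: of_nat_sum)
  also have "\<dots> \<le> (\<Sum>i\<in>I. N i)" using T by (intro sum_mono) auto
  finally have "real (card (\<Union>i\<in>I. T i)) \<le> (\<Sum>i\<in>I. N i)" .
  moreover have "(\<Union>i\<in>I. A i) \<subseteq> (\<Union>t\<in>(\<Union>i\<in>I. T i). cball t \<rho>)" using T by blast
  ultimately show ?thesis
    unfolding ball_coverable_def using T assms(1) by (intro exI[of _ "\<Union>i\<in>I. T i"]) auto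
qed

text \<open>
  Covering each piece \<open>f\<^sub>i(S)\<close> by the image of a cover of \<open>S\<close> at scale \<open>\<rho> / r\<^sub>i\<close> gives
  \<open>N(\<rho>) \<le> \<Sum>\<^sub>i N(\<rho> / r\<^sub>i)\<close>, and the bound \<open>C * \<rho> powr - s\<close> reproduces itself under this recursion by the choice
  of \<open>s\<close>. Since \<open>\<rho> / r\<^sub>i\<close> can exceed the radius \<open>R\<close> of \<open>S\<close> when \<open>\<rho>\<close> does not, the bound is claimed up to \<open>R / q\<close>,
  where \<open>q\<close> is a lower bound for the ratios.
\<close>

lemma dim_D_self_similar_le:
  fixes S :: "'a::euclidean_space set"
  assumes D: "D \<in> sorgenfrey_family" and S: "self_similar m f r S"
    and s: "(\<Sum>i<m. r i powr s) = 1" "0 \<le> s"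
  shows "dim_D D S \<le> ereal s"
proof -
  obtain q Q where qQ: "0 < q" "0 < Q" "Q < 1" "\<And>i. i < m \<Longrightarrow> q \<le> r i \<and> r i \<le> Q"
    using self_similar_ratio_bounds[OF S] by metis
  have sim: "contracting_similarity (r i) (f i)" if "i < m" for i
    using S that by (simp add: self_similar_def)
  then have r: "0 < r i" if "i < m" for i
    using that by (auto simp: contracting_similarity_def)
  have compS: "compact S" "S \<noteq> {}" and S_eq: "S = (\<Union>i<m. f i ` S)"
    using S by (auto simp: self_similar_def)
  obtain a where "a \<in> S" using compS(2) by blast
  obtain R where R: "0 < R" "S \<subseteq> cball a R"
    using compact_imp_bounded[OF compS(1)] bounded_subset_ballD[of S a] ball_subset_cball
    by blast
  define C where "C = (R / q) powr s"
  have cov: "ball_coverable S \<rho> (C * \<rho> powr - s)" if "R * Q ^ k \<le> \<rho>" "\<rho> \<le> R / q" for k \<rho>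
    using that
  proof (induction k arbitrary: \<rho>)
    case 0
    then have "0 < \<rho>" using R(1) by auto
    have "\<rho> powr s \<le> C" unfolding C_def using 0 \<open>0 < \<rho>\<close> s(2) by (intro powr_mono2) auto
    then have "1 \<le> C * \<rho> powr - s" using \<open>0 < \<rho>\<close> by (simp add: powr_minus field_simps)
    moreover have "S \<subseteq> cball a \<rho>" using R(2) 0 by auto
    ultimately show ?case unfolding ball_coverable_def by (intro exI[of _ "{a}"]) auto
  next
    case (Suc k)
    have "0 < \<rho>" using Suc.prems(1) R(1) qQ(2) by (smt (verit) mult_pos_pos zero_less_power)
    show ?case
    proof (cases "R \<le> \<rho>")
      case True
      have "R * Q ^ k \<le> R" using R(1) qQ by (simp add: mult_le_cancel_left1 power_le_one)
      then show ?thesis using Suc True by simp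
    next
      case False
      have "ball_coverable (f i ` S) \<rho> (C * (\<rho> / r i) powr - s)" if "i < m" for i
      proof (rule ball_coverable_similarity_image)
        show "dist (f i x) (f i y) = r i * dist x y" for x y
          using sim[OF that] by (simp add: contracting_similarity_def)
        show "0 < r i" using r that .
        show "ball_coverable S (\<rho> / r i) (C * (\<rho> / r i) powr - s)"
        proof (rule Suc.IH)
          have "R * Q ^ k * r i \<le> R * Q ^ k * Q"
            using R(1) qQ that by (intro mult_left_mono) auto
          also have "\<dots> \<le> \<rho>" using Suc.prems(1) by (simp add: mult_ac)
          finally show "R * Q ^ k \<le> \<rho> / r i" using r[OF that] by (simp add: pos_le_divide_eq)
          show "\<rho> / r i \<le> R / q"
            using False \<open>0 < \<rho>\<close> qQ that R(1) by (intro frac_le) auto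
        qed
      qed
      then have "ball_coverable (\<Union>i<m. f i ` S) \<rho> (\<Sum>i<m. C * (\<rho> / r i) powr - s)"
        by (intro ball_coverable_UN) auto
      moreover have "(\<Sum>i<m. C * (\<rho> / r i) powr - s) = (\<Sum>i<m. C * \<rho> powr - s * r i powr s)"
        using r \<open>0 < \<rho>\<close> by (intro sum.cong) (auto simp: powr_divide powr_minus field_simps)
      moreover have "(\<Sum>i<m. C * \<rho> powr - s * r i powr s) = C * \<rho> powr - s"
        using s(1) by (simp flip: sum_distrib_left)
      ultimately show ?thesis
        using S_eq by metis
    qed
  qed
  show ?thesis
  proof (rule dim_D_le_box_dimension[OF D s(2)])
    show "0 < R / q" using R(1) qQ(1) by simp
    fix \<rho> assume \<rho>: "0 < \<rho>" "\<rho> < R / q"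
    obtain k where "Q ^ k < \<rho> / R" using real_arch_pow_inv[of "\<rho> / R" Q] \<rho> R(1) qQ by auto
    then have "R * Q ^ k \<le> \<rho>" using R(1) by (simp add: field_simps)
    then show "ball_coverable S \<rho> (C * \<rho> powr - s)" using \<rho> by (intro cov) auto
  qed
qed

lemma dim_D_self_similar:
  fixes S :: "'a::euclidean_space set"
  assumes D: "D \<in> sorgenfrey_family"
    and S: "self_similar m f r S" "strong_separation m f S"
  shows "dim_D D S = ereal (similarity_dim m r)"
proof -
  let ?s = "similarity_dim m r"
  have "0 < m" using self_similar_ratio_bounds[OF S(1)] by metis
  moreover have "0 < r i \<and> r i < 1" if "i < m" for i
    using S(1) that by (auto simp: self_similar_def contracting_similarity_def)
  ultimately have s: "(\<Sum>i<m. r i powr ?s) = 1" "0 \<le> ?s"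
    using similarity_dim_equation[of m r] by blast+
  show ?thesis
  proof (rule antisym)
    show "dim_D D S \<le> ereal ?s" by (rule dim_D_self_similar_le[OF D S(1) s])
    show "ereal ?s \<le> dim_D D S"
    proof (cases "?s = 0")
      case True
      then show ?thesis using dim_D_nonneg[of D S] by (simp add: zero_ereal_def)
    next
      case False
      then show ?thesis using dim_D_self_similar_ge[OF D S s(1)] s(2) by simp
    qed
  qed
qed

section \<open>A Cantor set that separates the dimensions\<close>

text \<open>
  The blocks are disjoint for \<open>k \<ge> 1\<close>, and all the blocks before \<open>k!\<close> end at \<open>2 (k - 1)! = o(k!)\<close>. That is
  why factorials are used.
\<close>

definition sparse_positions :: "nat set" where
  "sparse_positions = (\<Union>k. {fact k..<2 * fact k})"

definition digit_bound :: "nat \<Rightarrow> nat" where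
  "digit_bound j = (if j \<in> sparse_positions then 2 else 1)"

text \<open>
  In base \<open>4\<close> the digits \<open>0\<close> and \<open>1\<close> leave gaps: points that first differ in digit \<open>j\<close> are at distance at least
  \<open>4\<^sup>-\<^sup>j - (4\<^sup>-\<^sup>j\<^sup>-\<^sup>1 + 4\<^sup>-\<^sup>j\<^sup>-\<^sup>2 + \<dots>) = (2 / 3) 4\<^sup>-\<^sup>j\<close>.
\<close>

definition digit_point :: "(nat \<Rightarrow> nat) \<Rightarrow> 'a::euclidean_space" where
  "digit_point \<sigma> = (\<Sum>j. real (\<sigma> j) * (1 / 4) ^ j) *\<^sub>R (SOME b. b \<in> Basis)"

definition factorial_cantor_set :: "'a::euclidean_space set" where
  "factorial_cantor_set = digit_point ` addresses digit_bound"

definition position_count :: "nat \<Rightarrow> nat" where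
  "position_count j = card (sparse_positions \<inter> {..<j})"

definition factorial_scales :: "real \<Rightarrow> real set" where
  "factorial_scales x = (\<Union>k::nat. {4 powr (- (x * fact k))..<2 * 4 powr (- (x * fact k))})"

lemma mem_factorial_scales_iff:
  "d \<in> factorial_scales x \<longleftrightarrow> (\<exists>k. 4 powr (- (x * fact k)) \<le> d \<and> d < 2 * 4 powr (- (x * fact k)))"
  by (simp add: factorial_scales_def)

lemma factorial_scales_base: "4 powr (- (x * fact k)) \<in> factorial_scales x"
  unfolding mem_factorial_scales_iff by (intro exI[of _ k]) simp

lemma digit_bound_pos: "0 < digit_bound j"
  by (simp add: digit_bound_def)

lemma digit_le_1: "\<sigma> \<in> addresses digit_bound \<Longrightarrow> \<sigma> j \<le> 1"
proof -
  assume "\<sigma> \<in> addresses digit_bound"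
  then have "\<sigma> j < digit_bound j" by (simp add: addresses_def)
  then show ?thesis by (auto simp: digit_bound_def split: if_splits)
qed

lemma position_count_Suc: "2 ^ position_count (Suc j) = digit_bound j * 2 ^ position_count j"
proof (cases "j \<in> sparse_positions")
  case True
  then have "sparse_positions \<inter> {..<Suc j} = insert j (sparse_positions \<inter> {..<j})"
    by (auto simp: less_Suc_eq)
  then show ?thesis using True by (simp add: position_count_def digit_bound_def)
next
  case False
  then have "sparse_positions \<inter> {..<Suc j} = sparse_positions \<inter> {..<j}"
    by (auto simp: less_Suc_eq)
  then show ?thesis using False by (simp add: position_count_def digit_bound_def)
qed

lemma position_count_ge: "min j (2 * fact k) - fact k \<le> position_count j"
proof -
  have "card {fact k..<min j (2 * fact k)} \<le> position_count j"
    unfolding position_count_def by (intro card_mono) (auto simp: sparse_positions_def)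
  then show ?thesis by simp
qed

lemma position_count_le: "position_count j \<le> 2 * fact k + (j - fact (Suc k))"
proof -
  have "sparse_positions \<inter> {..<j} \<subseteq> {..<2 * fact k} \<union> {fact (Suc k)..<j}"
  proof
    fix i assume i: "i \<in> sparse_positions \<inter> {..<j}"
    then obtain l where l: "fact l \<le> i" "i < 2 * fact l" by (auto simp: sparse_positions_def)
    show "i \<in> {..<2 * fact k} \<union> {fact (Suc k)..<j}"
    proof (cases "l \<le> k")
      case True
      then have "(fact l :: nat) \<le> fact k" by (rule fact_mono)
      then show ?thesis using l(2) by simp
    next
      case False
      then have "(fact (Suc k) :: nat) \<le> fact l" by (intro fact_mono) simp
      then show ?thesis using i l(1) by simp
    qed
  qed
  then have "position_count j \<le> card ({..<2 * fact k} \<union> {fact (Suc k)..<j})"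
    unfolding position_count_def by (intro card_mono) auto
  also have "\<dots> \<le> card {..<2 * fact k :: nat} + card {fact (Suc k)..<j}"
    by (rule card_Un_le)
  finally show ?thesis by simp
qed

lemma digit_series_tail:
  fixes a :: "nat \<Rightarrow> real"
  assumes "\<And>j. \<bar>a j\<bar> \<le> 1"
  shows "summable (\<lambda>j. a j * (1 / 4) ^ (j + J))" "\<bar>\<Sum>j. a j * (1 / 4) ^ (j + J)\<bar> \<le> 4 / 3 * (1 / 4) ^ J"
proof -
  have le: "norm (a j * (1 / 4) ^ (j + J)) \<le> (1 / 4) ^ J * (1 / 4) ^ j" for j
    using mult_right_mono[OF assms[of j], of "(1 / 4) ^ (j + J)"] by (simp add: abs_mult power_add mult.commute)
  have geo: "(\<lambda>j. (1 / 4) ^ J * (1 / 4) ^ j) sums ((1 / 4) ^ J * (1 / (1 - 1 / 4 :: real)))"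
    by (intro sums_mult geometric_sums) auto
  show "summable (\<lambda>j. a j * (1 / 4) ^ (j + J))"
    by (rule summable_comparison_test'[OF sums_summable[OF geo] le])
  have "norm (\<Sum>j. a j * (1 / 4) ^ (j + J)) \<le> (\<Sum>j. (1 / 4) ^ J * (1 / 4) ^ j)"
    by (rule norm_suminf_le[OF le sums_summable[OF geo]])
  also have "\<dots> = 4 / 3 * (1 / 4) ^ J"
    using sums_unique[OF geo] by simp
  finally show "\<bar>\<Sum>j. a j * (1 / 4) ^ (j + J)\<bar> \<le> 4 / 3 * (1 / 4) ^ J" by simp
qed

lemma digit_point_dist:
  assumes \<sigma>: "\<And>j. \<sigma> j \<le> 1" and \<tau>: "\<And>j. \<tau> j \<le> 1" and agree: "\<And>j. j < J \<Longrightarrow> \<sigma> j = \<tau> j"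
  shows "dist (digit_point \<sigma> :: 'a::euclidean_space) (digit_point \<tau>)
    = \<bar>\<Sum>j. (real (\<sigma> (j + J)) - real (\<tau> (j + J))) * (1 / 4) ^ (j + J)\<bar>"
proof -
  have b: "norm (SOME b::'a. b \<in> Basis) = 1"
    by (intro norm_Basis someI_ex[of "\<lambda>b. b \<in> Basis"]) (use nonempty_Basis in blast)
  have sm: "summable (\<lambda>j. real (\<sigma> j) * (1 / 4) ^ j)" "summable (\<lambda>j. real (\<tau> j) * (1 / 4) ^ j)"
    using digit_series_tail(1)[of "\<lambda>j. real (\<sigma> j)" 0] digit_series_tail(1)[of "\<lambda>j. real (\<tau> j)" 0] \<sigma> \<tau>
    by simp_all
  have "dist (digit_point \<sigma> :: 'a) (digit_point \<tau>)
      = \<bar>(\<Sum>j. real (\<sigma> j) * (1 / 4) ^ j) - (\<Sum>j. real (\<tau> j) * (1 / 4) ^ j)\<bar>"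
    unfolding digit_point_def dist_norm by (simp add: b flip: scaleR_diff_left)
  also have "(\<Sum>j. real (\<sigma> j) * (1 / 4) ^ j) - (\<Sum>j. real (\<tau> j) * (1 / 4) ^ j)
      = (\<Sum>j. (real (\<sigma> j) - real (\<tau> j)) * (1 / 4) ^ j)"
    using suminf_diff[OF sm] by (simp add: left_diff_distrib)
  also have "\<dots> = (\<Sum>j. (real (\<sigma> (j + J)) - real (\<tau> (j + J))) * (1 / 4) ^ (j + J))
      + (\<Sum>j<J. (real (\<sigma> j) - real (\<tau> j)) * (1 / 4) ^ j)"
    using summable_diff[OF sm] by (intro suminf_split_initial_segment) (simp add: left_diff_distrib)
  also have "(\<Sum>j<J. (real (\<sigma> j) - real (\<tau> j)) * (1 / 4) ^ j) = 0"
    using agree by (intro sum.neutral) auto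
  finally show ?thesis by simp
qed

lemma digit_diff_le_1:
  fixes a b :: nat
  shows "a \<le> 1 \<Longrightarrow> b \<le> 1 \<Longrightarrow> \<bar>real a - real b\<bar> \<le> 1"
  by linarith

lemma digit_point_dist_le:
  assumes "\<And>j. \<sigma> j \<le> 1" "\<And>j. \<tau> j \<le> 1" "\<And>j. j < J \<Longrightarrow> \<sigma> j = \<tau> j"
  shows "dist (digit_point \<sigma> :: 'a::euclidean_space) (digit_point \<tau>) \<le> 4 / 3 * (1 / 4) ^ J"
proof -
  have "dist (digit_point \<sigma> :: 'a) (digit_point \<tau>)
      = \<bar>\<Sum>j. (real (\<sigma> (j + J)) - real (\<tau> (j + J))) * (1 / 4) ^ (j + J)\<bar>"
    by (rule digit_point_dist) (use assms in auto)
  also have "\<dots> \<le> 4 / 3 * (1 / 4) ^ J"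
    using assms(1,2) by (intro digit_series_tail(2) digit_diff_le_1)
  finally show ?thesis .
qed

lemma digit_point_dist_ge:
  assumes \<sigma>: "\<And>j. \<sigma> j \<le> 1" and \<tau>: "\<And>j. \<tau> j \<le> 1" and agree: "\<And>j. j < J \<Longrightarrow> \<sigma> j = \<tau> j"
    and differ: "\<sigma> J \<noteq> \<tau> J"
  shows "2 / 3 * (1 / 4) ^ J \<le> dist (digit_point \<sigma> :: 'a::euclidean_space) (digit_point \<tau>)"
proof -
  let ?a = "\<lambda>j. real (\<sigma> (j + J)) - real (\<tau> (j + J))"
  let ?T = "\<Sum>j. ?a (Suc j) * (1 / 4) ^ (j + Suc J)"
  have "\<bar>?a j\<bar> \<le> 1" for j using \<sigma> \<tau> by (intro digit_diff_le_1)
  note tail = digit_series_tail[of "\<lambda>j. ?a j", OF this] digit_series_tail[of "\<lambda>j. ?a (Suc j)" "Suc J", OF this]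
  have "(\<Sum>j. ?a j * (1 / 4) ^ (j + J)) = ?T + ?a 0 * (1 / 4) ^ J"
    using suminf_split_initial_segment[OF tail(1)[of J], of 1] by simp
  moreover have "\<bar>?T\<bar> \<le> 1 / 3 * (1 / 4) ^ J" using tail(4) by simp
  moreover have "\<bar>?a 0\<bar> = 1" using \<sigma>[of J] \<tau>[of J] differ by (auto simp: le_Suc_eq)
  then have "\<bar>?a 0 * (1 / 4) ^ J\<bar> = (1 / 4) ^ J" by (simp add: abs_mult)
  moreover have "dist (digit_point \<sigma> :: 'a) (digit_point \<tau>) = \<bar>\<Sum>j. ?a j * (1 / 4) ^ (j + J)\<bar>"
    by (rule digit_point_dist) (use \<sigma> \<tau> agree in auto)
  ultimately show ?thesis by linarith
qed

lemma factorial_scales_in_family: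
  assumes "0 < x"
  shows "factorial_scales x \<in> sorgenfrey_family"
proof -
  let ?a = "\<lambda>k::nat. 4 powr (- (x * fact k))"
  have mem: "?a k \<in> factorial_scales x" for k
    by (rule factorial_scales_base)
  have pos: "0 < d" if d: "d \<in> factorial_scales x" for d
  proof -
    obtain k where "?a k \<le> d" using d unfolding mem_factorial_scales_iff by blast
    moreover have "0 < ?a k" by simp
    ultimately show ?thesis by (rule less_le_trans[rotated])
  qed
  have "Inf (factorial_scales x) = 0"
  proof (rule cInf_eq_non_empty)
    show "factorial_scales x \<noteq> {}" using mem by blast
    show "0 \<le> d" if "d \<in> factorial_scales x" for d using pos[OF that] by simp
    fix y assume y: "\<And>d. d \<in> factorial_scales x \<Longrightarrow> y \<le> d"
    show "y \<le> 0"
    proof (rule ccontr)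
      assume "\<not> y \<le> 0"
      then obtain k where k: "(4 powr - x) ^ k < y"
        using real_arch_pow_inv[of y "4 powr - x"] \<open>0 < x\<close> powr_less_cancel_iff[of 4 "- x" 0] by auto
      have "?a k \<le> 4 powr (- (x * real k))"
        using \<open>0 < x\<close> fact_ge_self[of k] of_nat_mono[OF fact_ge_self[of k], where 'a = real]
        by (intro powr_mono) auto
      also have "\<dots> = (4 powr - x) ^ k"
        by (simp add: powr_powr flip: powr_realpow)
      finally show False using k y[OF mem[of k]] by simp
    qed
  qed
  moreover have "\<exists>\<delta>>0. {t..<t + \<delta>} \<subseteq> factorial_scales x" if t: "t \<in> factorial_scales x" for t
  proof -
    obtain k where k: "?a k \<le> t" "t < 2 * ?a k"
      using t unfolding mem_factorial_scales_iff by blast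
    have "u \<in> factorial_scales x" if "t \<le> u" "u < 2 * ?a k" for u
      unfolding mem_factorial_scales_iff using k(1) that by (intro exI[of _ k]) linarith
    then have "{t..<t + (2 * ?a k - t)} \<subseteq> factorial_scales x" by auto
    moreover have "0 < 2 * ?a k - t" using k(2) by linarith
    ultimately show ?thesis by blast
  qed
  moreover have "factorial_scales x \<subseteq> {0<..}" using pos by auto
  moreover have "factorial_scales x \<noteq> {}" using mem by blast
  ultimately show ?thesis
    unfolding sorgenfrey_family_def by simp
qed

text \<open>
  A node of depth \<open>j\<close> gets the mass \<open>1 / (2 N)\<close>, where \<open>N\<close> is the number of nodes of that depth. If a
  scale \<open>d < 2 * 4 powr (- x * k!)\<close> of \<open>D\<close> is at least the gap at depth \<open>j\<close>, then \<open>j > x * k! - 1\<close>, so the \<open>k\<close>-th block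
  has already contributed \<open>(x - 1) * k! - 1\<close> free digits; here \<open>x \<le> 2\<close> ensures that the block
  extends up to position \<open>x * k!\<close>.
  The factor \<open>1 / 2\<close> in the mass absorbs the \<open>- 1\<close>.
\<close>

lemma dim_D_factorial_cantor_set_ge:
  assumes x: "1 < x" "x \<le> 2"
  shows "ereal ((x - 1) / (2 * x)) \<le> dim_D (factorial_scales x) (factorial_cantor_set :: 'a::euclidean_space set)"
proof (rule dim_D_ge)
  let ?D = "factorial_scales x"
  let ?s = "(x - 1) / (2 * x)"
  let ?\<mu> = "\<lambda>w::nat list. (1 / 2) * (1 / 2) ^ position_count (length w) :: real"
  let ?\<gamma> = "\<lambda>w::nat list. 2 / 3 * (1 / 4) ^ length w :: real"
  show D: "?D \<in> sorgenfrey_family" using x by (intro factorial_scales_in_family) simp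
  have "ennreal (?\<mu> []) \<le> content_D ?D ?s (digit_point ` addresses digit_bound :: 'a set)"
  proof (rule content_ge_tree_mass[where \<gamma> = ?\<gamma> and \<mu> = ?\<mu>])
    show "0 < d" if "d \<in> ?D" for d using D that by (rule sorgenfrey_family_pos)
    show "?\<gamma> (map \<sigma> [0..<k]) \<le> dist (digit_point \<sigma> :: 'a) (digit_point \<tau>)"
      if "\<sigma> \<in> addresses digit_bound" "\<tau> \<in> addresses digit_bound" "\<forall>j<k. \<sigma> j = \<tau> j" "\<sigma> k \<noteq> \<tau> k" for \<sigma> \<tau> k
      using digit_point_dist_ge[of \<sigma> \<tau> k] digit_le_1 that by simp
    show "(\<lambda>k. ?\<gamma> (map \<sigma> [0..<k])) \<longlonglongrightarrow> 0" for \<sigma>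
    proof -
      have "(\<lambda>k. 2 / 3 * (1 / 4) ^ k) \<longlonglongrightarrow> (0::real)"
        by (intro tendsto_mult_right_zero LIMSEQ_power_zero) simp
      then show ?thesis by simp
    qed
    show "?\<mu> w \<le> (\<Sum>i<digit_bound (length w). ?\<mu> (w @ [i]))" for w
    proof -
      have "real (2 ^ position_count (Suc (length w))) = real (digit_bound (length w) * 2 ^ position_count (length w))"
        by (simp only: position_count_Suc)
      then show ?thesis using digit_bound_pos[of "length w"] by (simp add: power_one_over divide_simps)
    qed
    show "?\<mu> w \<le> d powr ?s" if d: "d \<in> ?D" "?\<gamma> w \<le> d" for w d
    proof -
      define j where "j = length w"
      obtain k where k: "4 powr (- (x * fact k)) \<le> d" "d < 2 * 4 powr (- (x * fact k))"
        using d(1) unfolding mem_factorial_scales_iff by blast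
      let ?m = "fact k :: nat"
      have "4 powr (- real j) = (1 / 4) ^ j"
        by (simp add: powr_minus powr_realpow power_one_over inverse_eq_divide)
      also have "\<dots> \<le> 3 / 2 * d" using d(2) by (simp add: j_def)
      also have "\<dots> < 4 * 4 powr (- (x * fact k))"
        using k(2) powr_gt_zero[of 4 "- (x * fact k)"] by linarith
      also have "\<dots> = 4 powr (1 - x * fact k)" by (simp add: powr_diff powr_minus divide_inverse)
      finally have j: "x * fact k - 1 < real j" by simp
      have "x * fact k \<le> 2 * fact k" using x(2) by (intro mult_right_mono) auto
      then have "x * fact k - 1 \<le> min (real j) (2 * fact k)"
        using j by linarith
      also have "\<dots> = real (min j (2 * ?m))" by (simp add: of_nat_min)
      also have "\<dots> \<le> real ?m + real (position_count j)"
        using position_count_ge[of j k] by linarith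
      finally have "(x - 1) * fact k \<le> 1 + real (position_count j)"
        by (simp add: algebra_simps)
      then have "2 powr (- (1 + real (position_count j))) \<le> 2 powr (- ((x - 1) * fact k))"
        by (intro powr_mono) auto
      also have "\<dots> = (4 powr (- (x * fact k))) powr ?s"
      proof -
        have "(4::real) powr (- (x * fact k)) = 2 powr (2 * (- (x * fact k)))"
          using powr_powr[of 2 2 "- (x * fact k)"] by simp
        moreover have "2 * (- (x * fact k)) * ?s = - ((x - 1) * fact k)"
          using x by (simp add: field_simps)
        ultimately show ?thesis by (simp add: powr_powr)
      qed
      also have "\<dots> \<le> d powr ?s" using k(1) x by (intro powr_mono2) auto
      finally show ?thesis
        unfolding j_def[symmetric] powr_minus powr_add
        by (simp add: powr_realpow power_one_over inverse_eq_divide)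
    qed
  qed simp
  then show "content_D ?D ?s (factorial_cantor_set :: 'a set) \<noteq> 0"
    unfolding factorial_cantor_set_def by (auto simp: position_count_def)
qed

lemma factorial_cantor_set_ball_coverable:
  assumes "4 / 3 * (1 / 4) ^ J \<le> \<rho>"
  shows "ball_coverable (factorial_cantor_set :: 'a::euclidean_space set) \<rho> (2 ^ position_count J)"
proof -
  define trunc where "trunc \<sigma> = (\<lambda>j. if j < J then \<sigma> j else (0::nat))" for \<sigma>
  define Z where "Z = (\<Pi>\<^sub>E j\<in>{..<J}. {..<digit_bound j})"
  define T where "T = (\<lambda>\<sigma>. digit_point (trunc \<sigma>) :: 'a) ` Z"
  have "finite Z" unfolding Z_def by (intro finite_PiE) auto
  have "card Z = (\<Prod>j<J. digit_bound j)" unfolding Z_def by (simp add: card_PiE)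
  also have "\<dots> = 2 ^ position_count J"
    by (induction J) (simp_all add: position_count_Suc mult.commute, simp add: position_count_def)
  finally have "card T \<le> 2 ^ position_count J"
    unfolding T_def using card_image_le[OF \<open>finite Z\<close>, of "\<lambda>\<sigma>. digit_point (trunc \<sigma>) :: 'a"] by simp
  then have "real (card T) \<le> 2 ^ position_count J"
    by (metis of_nat_le_iff of_nat_numeral of_nat_power)
  moreover have "factorial_cantor_set \<subseteq> (\<Union>t\<in>T. cball t \<rho>)"
  proof
    fix y :: 'a assume "y \<in> factorial_cantor_set"
    then obtain \<sigma> where \<sigma>: "\<sigma> \<in> addresses digit_bound" "y = digit_point \<sigma>"
      by (auto simp: factorial_cantor_set_def)
    have "restrict \<sigma> {..<J} \<in> Z" using \<sigma>(1) by (auto simp: Z_def addresses_def)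
    moreover have "trunc (restrict \<sigma> {..<J}) = trunc \<sigma>" by (auto simp: trunc_def)
    ultimately have "digit_point (trunc \<sigma>) \<in> T" unfolding T_def by (metis image_eqI)
    moreover have "dist (digit_point (trunc \<sigma>)) y \<le> 4 / 3 * (1 / 4) ^ J"
      unfolding \<sigma>(2) using digit_le_1[OF \<sigma>(1)] by (intro digit_point_dist_le) (auto simp: trunc_def)
    ultimately show "y \<in> (\<Union>t\<in>T. cball t \<rho>)" using assms by force
  qed
  ultimately show ?thesis
    unfolding ball_coverable_def T_def using \<open>finite Z\<close> by blast
qed

text \<open>
  Cover at the scale \<open>4 powr (- x * (k + 1)!)\<close> with \<open>k\<close> large. Up to this scale at most
  \<open>2 k! + (x - 1) (k + 1)! + 2\<close> digits are free, so the covering sum is at most \<open>2 powr E\<close> with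
  \<open>E = 2 k! + 2 - \<theta> (k + 1)!\<close>, where \<open>\<theta> = 2 x t - (x - 1)\<close> is positive when \<open>t\<close> exceeds \<open>(x - 1) / (2 x)\<close>. Once
  \<open>\<theta> k \<ge> 3\<close>, this is at most \<open>2 - k!\<close>.
\<close>

lemma dim_D_factorial_cantor_set_le:
  assumes x: "1 < x"
  shows "dim_D (factorial_scales x) (factorial_cantor_set :: 'a::euclidean_space set) \<le> ereal ((x - 1) / (2 * x))"
proof (rule dense_ge)
  let ?D = "factorial_scales x"
  have D: "?D \<in> sorgenfrey_family" using x by (intro factorial_scales_in_family) simp
  fix a assume "ereal ((x - 1) / (2 * x)) < a"
  then obtain t where t: "(x - 1) / (2 * x) < t" "ereal t < a"
    using ereal_dense2 by force
  have "0 < t" using t(1) x by (smt (verit) divide_nonneg_nonneg)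
  define \<theta> where "\<theta> = 2 * x * t - (x - 1)"
  have \<theta>: "0 < \<theta>" using t(1) x by (simp add: \<theta>_def field_simps)
  have "content_D ?D t (factorial_cantor_set :: 'a set) = 0"
  proof (rule content_zero_by_equal_balls[OF D \<open>0 < t\<close>])
    fix e :: real assume "0 < e"
    obtain l where l: "(1 / 2) ^ l < e / 4" using real_arch_pow_inv[of "e / 4" "1 / 2"] \<open>0 < e\<close> by auto
    obtain k where k: "max (real l) (3 / \<theta>) \<le> real k" using real_arch_simple by blast
    define d where "d = 4 powr (- (x * fact (Suc k)))"
    \<comment> \<open>The extra digit makes \<open>4 / 3 * 4\<^sup>-\<^sup>J\<close>, the size of a piece of depth \<open>J\<close>, at most the radius \<open>d / 2\<close>.\<close>
    define J where "J = nat \<lceil>x * fact (Suc k)\<rceil> + 1"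
    have J: "x * fact (Suc k) + 1 \<le> real J" "real J \<le> x * fact (Suc k) + 2"
    proof -
      have "0 \<le> x * fact (Suc k)" using x by simp
      then show "x * fact (Suc k) + 1 \<le> real J" "real J \<le> x * fact (Suc k) + 2"
        unfolding J_def by linarith+
    qed
    have "d \<in> ?D" unfolding d_def by (rule factorial_scales_base)
    moreover have "ball_coverable (factorial_cantor_set :: 'a set) (d / 2) (2 ^ position_count J)"
    proof (rule factorial_cantor_set_ball_coverable)
      have "(1 / 4) ^ J = 4 powr (- real J)"
        by (simp add: powr_minus powr_realpow power_one_over inverse_eq_divide)
      also have "\<dots> \<le> 4 powr (- (x * fact (Suc k)) - 1)" using J(1) by (intro powr_mono) auto
      also have "\<dots> = d / 4" by (simp add: d_def powr_diff)
      finally show "4 / 3 * (1 / 4) ^ J \<le> d / 2"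
        using powr_gt_zero[of 4 "- (x * fact (Suc k))"] unfolding d_def by linarith
    qed
    moreover have "2 ^ position_count J * d powr t \<le> e"
    proof -
      let ?n = "fact k :: real"
      have n: "1 \<le> ?n" "real k \<le> ?n"
        using of_nat_mono[OF fact_ge_self[of k], where 'a = real] by auto
      have S: "fact (Suc k) = (real k + 1) * ?n" by (simp add: algebra_simps)
      have "1 * fact (Suc k) \<le> x * fact (Suc k)" using x by (intro mult_right_mono) auto
      then have "real (fact (Suc k)) \<le> real J" unfolding of_nat_fact using J(1) by linarith
      then have "fact (Suc k) \<le> J" by (simp only: of_nat_le_iff)
      then have "real (position_count J) \<le> 2 * ?n + (real J - fact (Suc k))"
        using of_nat_mono[OF position_count_le[of J k], where 'a = real] by (simp add: of_nat_diff del: fact_Suc)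
      also have "\<dots> \<le> 2 * ?n + (x - 1) * fact (Suc k) + 2"
        using J(2) by (simp add: algebra_simps del: fact_Suc)
      finally have count: "real (position_count J) \<le> 2 * ?n + (x - 1) * fact (Suc k) + 2" .
      have "3 \<le> \<theta> * real k" using k \<theta> by (simp add: field_simps)
      then have "3 * ?n \<le> \<theta> * (real k + 1) * ?n"
        using \<theta> n by (intro mult_right_mono) (auto simp: algebra_simps)
      then have gap: "3 * ?n \<le> \<theta> * fact (Suc k)" unfolding S by (simp add: mult.assoc)
      have "2 ^ position_count J * d powr t = 2 powr (real (position_count J) - 2 * x * t * fact (Suc k))"
      proof -
        have "d = 2 powr (2 * (- (x * fact (Suc k))))"
          unfolding d_def using powr_powr[of 2 2 "- (x * fact (Suc k))"] by simp
        then have "d powr t = 2 powr (- (2 * x * t * fact (Suc k)))"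
          by (simp add: powr_powr mult_ac del: fact_Suc)
        then show ?thesis by (simp add: powr_diff powr_minus powr_realpow divide_inverse del: fact_Suc)
      qed
      also have "\<dots> \<le> 2 powr (2 - real l)"
      proof (intro powr_mono)
        have "real (position_count J) - 2 * x * t * fact (Suc k) \<le> 2 * ?n + 2 - \<theta> * fact (Suc k)"
          using count by (simp add: \<theta>_def algebra_simps del: fact_Suc)
        also have "\<dots> \<le> 2 - ?n" using gap by simp
        also have "\<dots> \<le> 2 - real l" using k n by simp
        finally show "real (position_count J) - 2 * x * t * fact (Suc k) \<le> 2 - real l" .
      qed simp
      also have "\<dots> = 4 * (1 / 2) ^ l"
        by (simp add: powr_diff powr_realpow power_one_over)
      also have "\<dots> \<le> e" using l by simp
      finally show ?thesis .
    qed
    ultimately show "\<exists>d\<in>?D. \<exists>N. ball_coverable (factorial_cantor_set :: 'a set) (d / 2) N \<and> N * d powr t \<le> e"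
      by blast
  qed
  then have "dim_D ?D (factorial_cantor_set :: 'a set) \<le> ereal t"
    using \<open>0 < t\<close> by (intro dim_D_le) auto
  then show "dim_D ?D (factorial_cantor_set :: 'a set) \<le> a" using t(2) by simp
qed

lemma dim_D_factorial_cantor_set:
  assumes "1 < x" "x \<le> 2"
  shows "dim_D (factorial_scales x) (factorial_cantor_set :: 'a::euclidean_space set) = ereal ((x - 1) / (2 * x))"
  using dim_D_factorial_cantor_set_ge[OF assms] dim_D_factorial_cantor_set_le[OF assms(1)] by (rule antisym[rotated])

lemma factorial_scales_dim_less:
  assumes "1 < y" "y < x" "x \<le> 2"
  shows "dim_D (factorial_scales y) (factorial_cantor_set :: 'a::euclidean_space set)
    < dim_D (factorial_scales x) (factorial_cantor_set :: 'a set)"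
  using assms by (simp add: dim_D_factorial_cantor_set field_simps)

section \<open>Continuum many dimensions\<close>

theorem corollary3p10:
  shows "\<exists>F :: ((real ^ 'n) set \<Rightarrow> ereal) set.
    F \<subseteq> dim_D ` sorgenfrey_family \<and> F \<approx> (UNIV :: real set) \<and>
    (\<forall>d\<in>F.
       d \<noteq> hausdorff_dim \<and>
       (\<forall>m f r S. self_similar m f r S \<and> strong_separation m f S \<longrightarrow>
          d S = ereal (similarity_dim m r)) \<and>
       (\<forall>A B. A \<subseteq> B \<longrightarrow> d A \<le> d B) \<and>
       (\<forall>A B. d (A \<union> B) = max (d A) (d B)) \<and>
       (\<forall>A B. bilipschitz_equivalent A B \<longrightarrow> d A = d B) \<and>
       (\<forall>f A. (\<exists>C. C-lipschitz_on UNIV f) \<longrightarrow> d (f ` A) \<le> d A) \<and>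
       (\<forall>A :: nat \<Rightarrow> (real ^ 'n) set. d (\<Union>i. A i) = (SUP i. d (A i))) \<and>
       (\<lambda>K. d (set_of_compacts K)) \<in>
          measurable borel (restrict_space borel {0..ereal (real CARD('n))}))"
proof -
  \<comment> \<open>A decreasing injection of the real line into the interval of admissible parameters.\<close>
  define x :: "real \<Rightarrow> real" where "x t = 1 + 1 / (1 + exp t)" for t
  have x: "1 < x t" "x t \<le> 2" for t
    by (auto simp: x_def field_simps add_pos_pos)
  have x_less: "x t < x u" if "u < t" for t u
    using that by (simp add: x_def frac_less2 add_pos_pos)
  define dm :: "real \<Rightarrow> (real ^ 'n) set \<Rightarrow> ereal" where "dm t = dim_D (factorial_scales (x t))" for t
  have D: "factorial_scales (x t) \<in> sorgenfrey_family" for t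
    using x[of t] by (intro factorial_scales_in_family) simp
  have "inj dm"
  proof (rule linorder_injI)
    fix t u :: real assume "t < u"
    then have "dm u factorial_cantor_set < dm t factorial_cantor_set"
      unfolding dm_def using x x_less by (intro factorial_scales_dim_less)
    then show "dm t \<noteq> dm u" by auto
  qed
  have hausdorff: "dm t \<noteq> hausdorff_dim" for t
  proof
    assume eq: "dm t = hausdorff_dim"
    have "hausdorff_dim (factorial_cantor_set :: (real ^ 'n) set) \<le> dm (t + 1) factorial_cantor_set"
      unfolding dm_def by (rule hausdorff_dim_le_dim_D[OF D])
    also have "\<dots> < dm t factorial_cantor_set"
      unfolding dm_def using x x_less[of t "t + 1"] by (intro factorial_scales_dim_less) auto
    finally show False unfolding eq by simp
  qed
  have measurable: "(\<lambda>K. dm t (set_of_compacts K)) \<in> measurable borel (restrict_space borel {0..ereal (real CARD('n))})" for t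
  proof (rule measurable_restrict_space2)
    show "(\<lambda>K. dm t (set_of_compacts K)) \<in> space borel \<rightarrow> {0..ereal (real CARD('n))}"
      using dim_D_nonneg dim_D_le_dimension[OF D, where 'a = "real ^ 'n"] by (auto simp: dm_def)
    show "(\<lambda>K. dm t (set_of_compacts K)) \<in> borel_measurable borel"
      unfolding dm_def by (rule dim_D_compacts_borel_measurable[OF D])
  qed
  show ?thesis
  proof (intro exI[of _ "range dm"] conjI ballI)
    show "range dm \<subseteq> dim_D ` sorgenfrey_family" using D by (auto simp: dm_def)
    show "range dm \<approx> (UNIV :: real set)" using \<open>inj dm\<close> by (rule inj_on_image_eqpoll_self)
    fix d assume "d \<in> range dm"
    then obtain t where d: "d = dm t" by blast
    show "d \<noteq> hausdorff_dim" unfolding d by (rule hausdorff)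
    show "\<forall>m f r S. self_similar m f r S \<and> strong_separation m f S \<longrightarrow> d S = ereal (similarity_dim m r)"
      unfolding d dm_def using dim_D_self_similar[OF D] by blast
    show "\<forall>A B. A \<subseteq> B \<longrightarrow> d A \<le> d B"
      unfolding d dm_def using dim_D_mono by blast
    show "\<forall>A B. d (A \<union> B) = max (d A) (d B)"
      unfolding d dm_def using dim_D_union[OF D] by blast
    show "\<forall>A B. bilipschitz_equivalent A B \<longrightarrow> d A = d B"
      unfolding d dm_def using dim_D_bilipschitz_eq[OF D] by blast
    show "\<forall>f A. (\<exists>C. C-lipschitz_on UNIV f) \<longrightarrow> d (f ` A) \<le> d A"
      unfolding d dm_def using dim_D_lipschitz_image_le[OF D lipschitz_on_subset] by blast
    show "\<forall>A :: nat \<Rightarrow> (real ^ 'n) set. d (\<Union>i. A i) = (SUP i. d (A i))"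
      unfolding d dm_def using dim_D_countable_union[OF D] by blast
    show "(\<lambda>K. d (set_of_compacts K)) \<in> measurable borel (restrict_space borel {0..ereal (real CARD('n))})"
      unfolding d by (rule measurable)
  qed
qed

end
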